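(* For every natural number $k \geq 1$, every $(13k-6)$-strong tournament $T$ in which every vertex has out-degree at least $28k-13$ is $k$-linked.
   Context: A tournament is a digraph with exactly one arc between every pair of distinct vertices. A digraph $D$ is $k$-strong if it has at least $k+1$ vertices and, for every set $S$ of at most $k-1$ vertices, $D-S$ is strongly connected (contains a directed path from $x$ to $y$ for every ordered pair of distinct vertices $x,y$). A digraph $D$ is $k$-linked if for every choice of disjoint vertex sets $\{x_1,\ldots,x_k\}$ and $\{y_1,\ldots,y_k\}$ (each consisting of $k$ distinct vertices) there exist pairwise vertex-disjoint directed paths $P_1,\ldots,P_k$ in $D$ such that $P_i$ is a directed path from $x_i$ to $y_i$ for each $i$. *)

theory Defs
  imports Main
begin

text \<open>A digraph is given by a vertex set V and an arc relation A (A x y: arc from x to y).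
Only arcs between vertices of V are relevant.\<close>

definition tournament :: "'a set \<Rightarrow> ('a \<Rightarrow> 'a \<Rightarrow> bool) \<Rightarrow> bool" where
  "tournament V A \<longleftrightarrow> finite V \<and>
     (\<forall>x y. A x y \<longrightarrow> x \<in> V \<and> y \<in> V) \<and>
     (\<forall>x. \<not> A x x) \<and>
     (\<forall>x\<in>V. \<forall>y\<in>V. x \<noteq> y \<longrightarrow> (A x y \<longleftrightarrow> \<not> A y x))"

definition dipath :: "'a set \<Rightarrow> ('a \<Rightarrow> 'a \<Rightarrow> bool) \<Rightarrow> 'a list \<Rightarrow> bool" where
  "dipath W A p \<longleftrightarrow> p \<noteq> [] \<and> distinct p \<and> set p \<subseteq> W \<and>
     (\<forall>i. Suc i < length p \<longrightarrow> A (p ! i) (p ! Suc i))"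

definition dipath_from_to :: "'a set \<Rightarrow> ('a \<Rightarrow> 'a \<Rightarrow> bool) \<Rightarrow> 'a list \<Rightarrow> 'a \<Rightarrow> 'a \<Rightarrow> bool" where
  "dipath_from_to W A p x y \<longleftrightarrow> dipath W A p \<and> hd p = x \<and> last p = y"

definition strongly_connected :: "'a set \<Rightarrow> ('a \<Rightarrow> 'a \<Rightarrow> bool) \<Rightarrow> bool" where
  "strongly_connected W A \<longleftrightarrow>
     (\<forall>x\<in>W. \<forall>y\<in>W. x \<noteq> y \<longrightarrow> (\<exists>p. dipath_from_to W A p x y))"

definition k_strong :: "nat \<Rightarrow> 'a set \<Rightarrow> ('a \<Rightarrow> 'a \<Rightarrow> bool) \<Rightarrow> bool" where
  "k_strong k V A \<longleftrightarrow> card V \<ge> k + 1 \<and>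
     (\<forall>S. S \<subseteq> V \<and> card S \<le> k - 1 \<longrightarrow> strongly_connected (V - S) A)"

definition out_degree :: "'a set \<Rightarrow> ('a \<Rightarrow> 'a \<Rightarrow> bool) \<Rightarrow> 'a \<Rightarrow> nat" where
  "out_degree V A x = card {y\<in>V. A x y}"

definition k_linked :: "nat \<Rightarrow> 'a set \<Rightarrow> ('a \<Rightarrow> 'a \<Rightarrow> bool) \<Rightarrow> bool" where
  "k_linked k V A \<longleftrightarrow>
     (\<forall>xs ys :: nat \<Rightarrow> 'a.
        inj_on xs {..<k} \<and> inj_on ys {..<k} \<and>
        xs ` {..<k} \<subseteq> V \<and> ys ` {..<k} \<subseteq> V \<and>
        xs ` {..<k} \<inter> ys ` {..<k} = {} \<longrightarrow>
        (\<exists>P :: nat \<Rightarrow> 'a list.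
           (\<forall>i<k. dipath_from_to V A (P i) (xs i) (ys i)) \<and>
           (\<forall>i<k. \<forall>j<k. i \<noteq> j \<longrightarrow> set (P i) \<inter> set (P j) = {})))"

end

theory Submission
  imports Defs
begin

text \<open>
  Write \<open>d v\<close> for the number of out-neighbours of \<open>v\<close> outside \<open>X = {x_1, \<dots>, x_k}\<close>, and let \<open>L\<close> be the
  \<open>5k\<close> vertices outside \<open>X \<union> Y\<close> with smallest \<open>d\<close>. A vertex with many out-neighbours
  of \<open>d\<close>-value at least \<open>d t\<close> reaches \<open>t\<close> by a path of length at most three, even when quite a few vertices are
  forbidden. Inside \<open>L\<close> choose entries \<open>e_1, \<dots>, e_k\<close> with many out-neighbours in a set
  \<open>S \<subseteq> L\<close> of vertices of moderate out-degree in \<open>L\<close>, and join each \<open>x_i\<close> to \<open>e_i\<close> by disjoint short paths. After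
  deleting these, Menger's theorem gives \<open>k\<close> disjoint paths from \<open>S\<close> to \<open>Y\<close>; take a
  system \<open>P_1, \<dots>, P_k\<close> of minimal total length. By minimality an unused vertex of \<open>S\<close> dominates at
  most the first two vertices of each \<open>P_j\<close>, and its out-neighbours off the paths at most the first
  three. So from an unused \<open>l_i \<in> S\<close> dominated by \<open>e_i\<close>, there is still room for a short path to the first vertex of
  the path \<open>P_i\<close> that ends in \<open>y_i\<close>; here the indexing of the \<open>P_i\<close> no longer matters.
\<close>

section \<open>Menger's theorem\<close>

definition walk :: "('a \<times> 'a) set \<Rightarrow> 'a list \<Rightarrow> bool" where
  "walk R p \<longleftrightarrow> p \<noteq> [] \<and> successively (\<lambda>u v. (u, v) \<in> R) p"

text \<open>Tested on walks rather than paths, so that two paths spliced at a common vertex can be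
  tested without first removing repetitions. One-vertex walks count, so \<open>Z\<close> has to
  contain every common vertex of \<open>S\<close> and \<open>B\<close>.\<close>

definition separates :: "('a \<times> 'a) set \<Rightarrow> 'a set \<Rightarrow> 'a set \<Rightarrow> 'a set \<Rightarrow> bool" where
  "separates R S B Z \<longleftrightarrow> (\<forall>p. walk R p \<longrightarrow> hd p \<in> S \<longrightarrow> last p \<in> B \<longrightarrow> set p \<inter> Z \<noteq> {})"

definition disjoint_paths :: "('a \<times> 'a) set \<Rightarrow> 'a set \<Rightarrow> 'a set \<Rightarrow> 'a list set \<Rightarrow> bool" where
  "disjoint_paths R S B \<P> \<longleftrightarrow> 
     (\<forall>p\<in>\<P>. walk R p \<and> distinct p \<and> hd p \<in> S \<and> last p \<in> B) \<and>
     (\<forall>p\<in>\<P>. \<forall>q\<in>\<P>. p \<noteq> q \<longrightarrow> set p \<inter> set q = {})"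

lemma walk_mono: "walk R p \<Longrightarrow> R \<subseteq> R' \<Longrightarrow> walk R' p"
  unfolding walk_def by (auto intro: successively_mono)

lemma walk_append_iff:
  "p \<noteq> [] \<Longrightarrow> q \<noteq> [] \<Longrightarrow> walk R (p @ q) \<longleftrightarrow> walk R p \<and> walk R q \<and> (last p, hd q) \<in> R"
  unfolding walk_def by (auto simp: successively_append_iff)

lemma walk_splice:
  assumes "walk R (p1 @ v # p2)" "walk R (q1 @ v # q2)"
  shows "walk R (p1 @ v # q2)"
  using assms unfolding walk_def by (auto simp: successively_append_iff)

text \<open>A walk using the new arc has \<open>x\<close> before its end and \<open>y\<close> after
  its start. The precise positions matter: a walk with \<open>x\<close> only at its end, or
  \<open>y\<close> only at its start, cannot use the arc.\<close>

lemma walk_edge_cases: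
  assumes "walk (insert (x, y) R) p"
  shows "walk R p \<or> x \<in> set (butlast p) \<and> y \<in> set (tl p)"
  using assms
proof (induction p)
  case (Cons a p)
  show ?case
  proof (cases p)
    case Nil then show ?thesis by (simp add: walk_def)
  next
    case (Cons b p')
    then have ab: "(a, b) = (x, y) \<or> (a, b) \<in> R" and w: "walk (insert (x, y) R) p"
      using Cons.prems by (auto simp: walk_def)
    from Cons.IH[OF w] ab Cons show ?thesis
      by (auto simp: walk_def dest: in_set_butlastD list.set_sel(2))
  qed
qed (simp add: walk_def)

lemma separates_insert_source:
  assumes "separates R S B Z" shows "separates (insert (x, y) R) S B (insert x Z)"
  unfolding separates_def
proof (intro allI impI)
  fix p assume p: "walk (insert (x, y) R) p" "hd p \<in> S" "last p \<in> B"
  from walk_edge_cases[OF p(1)] show "set p \<inter> insert x Z \<noteq> {}"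
    using assms p unfolding separates_def by (auto dest: in_set_butlastD)
qed

lemma separates_insert_target:
  assumes "separates R S B Z" shows "separates (insert (x, y) R) S B (insert y Z)"
  unfolding separates_def
proof (intro allI impI)
  fix p assume p: "walk (insert (x, y) R) p" "hd p \<in> S" "last p \<in> B"
  from walk_edge_cases[OF p(1)] have "walk R p \<or> y \<in> set p"
    by (metis list.set_sel(2) p(1) walk_def)
  then show "set p \<inter> insert y Z \<noteq> {}"
    using assms p unfolding separates_def by auto
qed

text \<open>Cut a walk at its first vertex in \<open>W\<close>. As \<open>x\<close> is in
  \<open>W\<close>, it can occur in the initial piece only at the end, so this piece does not use
  the new arc and \<open>Z\<close> meets it.\<close>

lemma separates_prefix:
  assumes W: "separates (insert (x, y) R) S B W" "x \<in> W" and Z: "separates R S W Z"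
  shows "separates (insert (x, y) R) S B Z"
  unfolding separates_def
proof (intro allI impI)
  fix p assume p: "walk (insert (x, y) R) p" "hd p \<in> S" "last p \<in> B"
  then have "\<exists>w\<in>set p. w \<in> W" using W unfolding separates_def by blast
  then obtain p1 w p2 where s: "p = p1 @ w # p2" "w \<in> W" "\<forall>v\<in>set p1. v \<notin> W"
    by (rule split_list_first_propE)
  have "walk (insert (x, y) R) (p1 @ [w])"
    using p(1) s(1) walk_append_iff[of "p1 @ [w]" p2] by (cases p2) auto
  then have "walk R (p1 @ [w])" using walk_edge_cases[of x y R "p1 @ [w]"] s(3) W(2) by auto
  moreover have "hd (p1 @ [w]) \<in> S" using p(2) s(1) by (cases p1) auto
  ultimately have "set (p1 @ [w]) \<inter> Z \<noteq> {}" using Z s(2) unfolding separates_def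
    by (metis last_snoc)
  then show "set p \<inter> Z \<noteq> {}" using s(1) by auto
qed

text \<open>Mirror image of the previous cut: after the last vertex in \<open>W\<close> there is no
  further \<open>y\<close>, so the final piece does not use the new arc.\<close>

lemma separates_suffix:
  assumes W: "separates (insert (x, y) R) S B W" "y \<in> W" and Z: "separates R W B Z"
  shows "separates (insert (x, y) R) S B Z"
  unfolding separates_def
proof (intro allI impI)
  fix p assume p: "walk (insert (x, y) R) p" "hd p \<in> S" "last p \<in> B"
  then have "\<exists>w\<in>set p. w \<in> W" using W unfolding separates_def by blast
  then obtain p1 w p2 where s: "p = p1 @ w # p2" "w \<in> W" "\<forall>v\<in>set p2. v \<notin> W"
    by (rule split_list_last_propE)
  have "walk (insert (x, y) R) (w # p2)"
    using p(1) s(1) walk_append_iff[of p1 "w # p2"] by (cases p1) auto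
  then have "walk R (w # p2)" using walk_edge_cases[of x y R "w # p2"] s(3) W(2) by auto
  moreover have "last (w # p2) \<in> B" using p(3) s(1) by auto
  ultimately have "set (w # p2) \<inter> Z \<noteq> {}" using Z s(2) unfolding separates_def
    by (metis list.sel(1))
  then show "set p \<inter> Z \<noteq> {}" using s(1) by auto
qed

lemma disjoint_paths_last_surj:
  assumes "disjoint_paths R S B \<P>" "card \<P> = card B" "finite B" "b \<in> B"
  shows "\<exists>p\<in>\<P>. last p = b"
proof -
  have "inj_on last \<P>"
  proof (rule inj_onI, rule ccontr)
    fix p q assume *: "p \<in> \<P>" "q \<in> \<P>" "last p = last q" "p \<noteq> q"
    then have "p \<noteq> []" "q \<noteq> []" "set p \<inter> set q = {}"
      using assms(1) unfolding disjoint_paths_def walk_def by auto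
    then show False using *(3) by (metis disjoint_iff last_in_set)
  qed
  then have "card (last ` \<P>) = card B" by (simp add: card_image assms)
  moreover have "last ` \<P> \<subseteq> B" using assms(1) unfolding disjoint_paths_def by auto
  ultimately have "last ` \<P> = B" using assms(3) by (simp add: card_subset_eq)
  then show ?thesis using assms(4) by auto
qed

lemma disjoint_paths_hd_surj:
  assumes "disjoint_paths R S B \<P>" "card \<P> = card S" "finite S" "b \<in> S"
  shows "\<exists>p\<in>\<P>. hd p = b"
proof -
  have "inj_on hd \<P>"
  proof (rule inj_onI, rule ccontr)
    fix p q assume *: "p \<in> \<P>" "q \<in> \<P>" "hd p = hd q" "p \<noteq> q"
    then have "p \<noteq> []" "q \<noteq> []" "set p \<inter> set q = {}"
      using assms(1) unfolding disjoint_paths_def walk_def by auto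
    then show False using *(3) by (metis disjoint_iff hd_in_set)
  qed
  then have "card (hd ` \<P>) = card S" by (simp add: card_image assms)
  moreover have "hd ` \<P> \<subseteq> S" using assms(1) unfolding disjoint_paths_def by auto
  ultimately have "hd ` \<P> = S" using assms(3) by (simp add: card_subset_eq)
  then show ?thesis using assms(4) by auto
qed

text \<open>A path ending in and a path starting in the separator can only meet there, since otherwise
  rerouting at the common vertex avoids it.\<close>
lemma glue_disjoint_paths:
  assumes sep: "separates R S B Z" and fin: "finite Z" and xy: "x \<notin> Z" "y \<notin> Z"
    and P: "disjoint_paths R S (insert x Z) \<P>" "card \<P> = Suc (card Z)"
    and Q: "disjoint_paths R (insert y Z) B \<Q>" "card \<Q> = Suc (card Z)"
  shows "\<exists>\<R>. disjoint_paths (insert (x, y) R) S B \<R> \<and> card \<R> = Suc (card Z)"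
proof -
  have "\<forall>s\<in>insert x Z. \<exists>p\<in>\<P>. last p = s"
    using disjoint_paths_last_surj[OF P(1)] P(2) fin xy by auto
  then obtain p where p: "\<And>s. s \<in> insert x Z \<Longrightarrow> p s \<in> \<P>" "\<And>s. s \<in> insert x Z \<Longrightarrow> last (p s) = s"
    by metis
  have "\<forall>s\<in>insert y Z. \<exists>p\<in>\<Q>. hd p = s"
    using disjoint_paths_hd_surj[OF Q(1)] Q(2) fin xy by auto
  then obtain q where q: "\<And>s. s \<in> insert y Z \<Longrightarrow> q s \<in> \<Q>" "\<And>s. s \<in> insert y Z \<Longrightarrow> hd (q s) = s"
    by metis
  have pw: "walk R (p s)" "distinct (p s)" "hd (p s) \<in> S" "p s \<noteq> []" if "s \<in> insert x Z" for s
    using p(1)[OF that] P(1) unfolding disjoint_paths_def walk_def by auto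
  have qw: "walk R (q s)" "distinct (q s)" "last (q s) \<in> B" "q s \<noteq> []" if "s \<in> insert y Z" for s
    using q(1)[OF that] Q(1) unfolding disjoint_paths_def walk_def by auto
  have pd: "s = t" if "s \<in> insert x Z" "t \<in> insert x Z" "v \<in> set (p s)" "v \<in> set (p t)" for s t v
    using p[OF that(1)] p[OF that(2)] P(1) that(3,4) unfolding disjoint_paths_def by fastforce
  have qd: "s = t" if "s \<in> insert y Z" "t \<in> insert y Z" "v \<in> set (q s)" "v \<in> set (q t)" for s t v
    using q[OF that(1)] q[OF that(2)] Q(1) that(3,4) unfolding disjoint_paths_def by fastforce
  have pin: "s \<in> set (p s)" if "s \<in> insert x Z" for s
    using p(2)[OF that] pw(4)[OF that] by (metis last_in_set)
  have qin: "s \<in> set (q s)" if "s \<in> insert y Z" for s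
    using q(2)[OF that] qw(4)[OF that] by (metis hd_in_set)
  have cross: "v = s \<and> v = t \<and> v \<in> Z" if st: "s \<in> insert x Z" "t \<in> insert y Z"
    and v: "v \<in> set (p s)" "v \<in> set (q t)" for s t v
  proof -
    obtain p1 p2 where ps: "p s = p1 @ v # p2" using v(1) by (meson split_list)
    obtain q1 q2 where qt: "q t = q1 @ v # q2" using v(2) by (meson split_list)
    have "walk R (p1 @ v # q2)" using walk_splice pw(1)[OF st(1)] qw(1)[OF st(2)] ps qt by metis
    moreover have "hd (p1 @ v # q2) \<in> S" using pw(3)[OF st(1)] ps by (cases p1) auto
    moreover have "last (p1 @ v # q2) \<in> B" using qw(3)[OF st(2)] qt by auto
    ultimately obtain z where z: "z \<in> Z" "z \<in> set (p1 @ v # q2)"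
      using sep unfolding separates_def by blast
    \<comment> \<open>The separator vertex \<open>z\<close> has its own path on either side. By
      disjointness it is the end of \<open>p s\<close> or the start of \<open>q t\<close>, and since
      these lists have no repetitions only the splicing point remains.\<close>
    have "z = v"
    proof (cases "z \<in> set p1 \<union> {v}")
      case True
      then have "z \<in> set (p s)" using ps by auto
      then have "s = z" using pd[OF st(1), of z z] pin[of z] z(1) by auto
      then have "last (v # p2) = z" using p(2)[OF st(1)] ps by simp
      moreover have "last (v # p2) \<in> set (v # p2)" by (rule last_in_set) simp
      ultimately show ?thesis using True pw(2)[OF st(1)] ps by auto
    next
      case False
      then have zq: "z \<in> set q2" using z(2) by auto
      then have "z \<in> set (q t)" using qt by auto
      then have "t = z" using qd[OF st(2), of z z] qin[of z] z(1) by auto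
      then have "hd (q1 @ v # q2) = z" using q(2)[OF st(2)] qt by simp
      then show ?thesis using zq qw(2)[OF st(2)] qt by (cases q1) auto
    qed
    then show ?thesis using pd[OF st(1), of v v] qd[OF st(2), of v v] pin[of v] qin[of v] z(1) v by auto
  qed
  \<comment> \<open>The path into \<open>x\<close> continues along the new arc to the path out of
    \<open>y\<close>. Any other separator vertex lies on both of its paths, so \<open>tl\<close>
    removes the second copy.\<close>
  define g where "g s = (if s = x then p x @ q y else p s @ tl (q s))" for s
  have qs: "q s = s # tl (q s)" if "s \<in> insert y Z" for s
    using q(2)[OF that] qw(4)[OF that] by (metis list.collapse)
  have gsub: "set (g s) \<subseteq> set (p s) \<union> set (q (if s = x then y else s))" if "s \<in> insert x Z" for s
    using that qw(4) unfolding g_def by (auto dest: list.set_sel(2))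
  have gne: "g s \<noteq> []" if "s \<in> insert x Z" for s
    using pw(4)[OF that] that unfolding g_def by auto
  have gdis: "set (g s) \<inter> set (g t) = {}" if st: "s \<in> insert x Z" "t \<in> insert x Z" "s \<noteq> t" for s t
  proof (rule ccontr)
    assume "\<not> ?thesis"
    then obtain v where v: "v \<in> set (g s)" "v \<in> set (g t)" by auto
    let ?f = "\<lambda>s. if s = x then y else s"
    have f: "?f s \<in> insert y Z" "?f t \<in> insert y Z" "?f s \<noteq> ?f t" using st xy by auto
    have "v \<in> set (p s) \<or> v \<in> set (q (?f s))" "v \<in> set (p t) \<or> v \<in> set (q (?f t))"
      using gsub st v by blast+
    then show False
      using pd[OF st(1,2)] qd[OF f(1,2)] cross[OF st(1) f(2)] cross[OF st(2) f(1)] st f(3) xy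
      by (metis)
  qed
  have "inj_on g (insert x Z)"
    using gdis gne by (intro inj_onI) (metis inf.idem set_empty)
  then have card: "card (g ` insert x Z) = Suc (card Z)" using fin xy by (simp add: card_image)
  have "walk (insert (x, y) R) (g s) \<and> distinct (g s) \<and> hd (g s) \<in> S \<and> last (g s) \<in> B"
    if s: "s \<in> insert x Z" for s
  proof (cases "s = x")
    case True
    have "walk (insert (x, y) R) (p x @ q y)"
      using pw[of x] qw[of y] p(2)[of x] q(2)[of y] by (auto simp: walk_append_iff intro: walk_mono)
    moreover have "set (p x) \<inter> set (q y) = {}" using cross[of x y] xy by auto
    ultimately show ?thesis using True pw[of x] qw[of y] by (auto simp: g_def)
  next
    case False
    then have sZ: "s \<in> Z" using s by auto
    obtain p1 where p1: "p s = p1 @ [s]" using p(2)[OF s] pw(4)[OF s] by (metis append_butlast_last_id)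
    have q1: "q s = [] @ s # tl (q s)" using qs[of s] sZ by simp
    have "walk R (p1 @ s # tl (q s))"
      by (rule walk_splice[of R p1 s "[]" "[]"]) (use pw(1)[OF s] p1 qw(1)[of s] q1 sZ in auto)
    then have 1: "walk (insert (x, y) R) (g s)" using False p1 unfolding g_def
      by (auto intro: walk_mono)
    have "set (p s) \<inter> set (tl (q s)) = {}"
    proof -
      have "s \<notin> set (tl (q s))" using qw(2)[of s] q1 sZ by (metis append_Nil distinct.simps(2) insertI2)
      then show ?thesis using cross[OF s, of s] sZ qw(4)[of s] by (auto dest: list.set_sel(2))
    qed
    then have 2: "distinct (g s)" using pw(2)[OF s] qw(2)[of s] sZ False
      by (simp add: g_def distinct_tl)
    have 3: "hd (g s) \<in> S" using pw(3,4)[OF s] False by (simp add: g_def)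
    have "g s = p1 @ q s" using False p1 q1 by (simp add: g_def)
    then have 4: "last (g s) \<in> B" using qw(3,4)[of s] sZ by simp
    show ?thesis using 1 2 3 4 by simp
  qed
  then have "disjoint_paths (insert (x, y) R) S B (g ` insert x Z)"
    unfolding disjoint_paths_def using gdis by (metis (no_types, lifting) imageE)
  then show ?thesis using card by blast
qed

text \<open>Goering's proof, by induction on the arcs.\<close>
theorem menger:
  assumes "finite R" "finite S" "\<And>Z. finite Z \<Longrightarrow> separates R S B Z \<Longrightarrow> k \<le> card Z"
  shows "\<exists>\<P>. disjoint_paths R S B \<P> \<and> card \<P> = k"
  using assms
proof (induction R arbitrary: S B k rule: finite_induct)
  case empty
  have "separates {} S B (S \<inter> B)"
    unfolding separates_def walk_def
  proof (intro allI impI)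
    fix p :: "'a list" assume "p \<noteq> [] \<and> successively (\<lambda>u v. (u, v) \<in> {}) p" "hd p \<in> S" "last p \<in> B"
    then show "set p \<inter> (S \<inter> B) \<noteq> {}" by (cases p rule: remdups_adj.cases) auto
  qed
  then have "k \<le> card (S \<inter> B)" using empty by simp
  then obtain K where K: "K \<subseteq> S \<inter> B" "card K = k" by (meson obtain_subset_with_card_n)
  have "disjoint_paths {} S B ((\<lambda>v. [v]) ` K)"
    using K unfolding disjoint_paths_def walk_def by auto
  moreover have "card ((\<lambda>v. [v]) ` K) = k" using K by (simp add: card_image inj_on_def)
  ultimately show ?case by blast
next
  case (insert e R)
  obtain x y where e: "e = (x, y)" by (cases e)
  show ?case
  proof (cases "\<forall>Z. finite Z \<longrightarrow> separates R S B Z \<longrightarrow> k \<le> card Z")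
    case True
    then obtain \<P> where "disjoint_paths R S B \<P>" "card \<P> = k" using insert by blast
    then have "disjoint_paths (insert e R) S B \<P> \<and> card \<P> = k"
      unfolding disjoint_paths_def by (auto intro: walk_mono)
    then show ?thesis by blast
  next
    case False
    then obtain Z where Z: "finite Z" "separates R S B Z" "card Z < k" by force
    note sx = separates_insert_source[OF Z(2), of x y] and sy = separates_insert_target[OF Z(2), of x y]
    \<comment> \<open>Adding either end of the new arc to \<open>Z\<close> also blocks the walks
      through that arc. Both enlarged sets thus have at least \<open>k\<close> elements, which
      leaves \<open>Z\<close> exactly one short and both ends outside it.\<close>
    have "k \<le> card (insert x Z)" "k \<le> card (insert y Z)" using insert.prems(2) sx sy Z(1) e by auto
    then have k: "k = Suc (card Z)" "x \<notin> Z" "y \<notin> Z" using Z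
      by (auto simp: card_insert_if split: if_splits)
    \<comment> \<open>A set separating \<open>S\<close> from \<open>insert x Z\<close> without the
      new arc separates \<open>S\<close> from \<open>B\<close> with it, so it inherits the lower
      bound \<open>k\<close>.\<close>
    obtain \<P> where P: "disjoint_paths R S (insert x Z) \<P>" "card \<P> = k"
      using insert.IH[of S "insert x Z" k] insert.prems separates_prefix[OF sx] e by blast
    obtain \<Q> where Q: "disjoint_paths R (insert y Z) B \<Q>" "card \<Q> = k"
      using insert.IH[of "insert y Z" B k] insert.prems separates_suffix[OF sy] e Z(1) by blast
    show ?thesis using glue_disjoint_paths[OF Z(2,1) k(2,3)] P Q k(1) e by metis
  qed
qed

section \<open>Out-degrees in tournaments\<close>

lemma card_UN_bound:
  assumes "finite I" "\<And>i. i \<in> I \<Longrightarrow> card (B i) \<le> b"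
  shows "card (\<Union>i\<in>I. B i) \<le> card I * b"
proof -
  have "card (\<Union>i\<in>I. B i) \<le> (\<Sum>i\<in>I. card (B i))" by (rule card_UN_le[OF assms(1)])
  also have "\<dots> \<le> card I * b" using sum_bounded_above[of I "\<lambda>i. card (B i)" b] assms(2) by simp
  finally show ?thesis .
qed

section \<open>Directed paths and reachability inside a vertex set\<close>

lemma dipath_iff: "dipath W A p \<longleftrightarrow> p \<noteq> [] \<and> distinct p \<and> set p \<subseteq> W \<and> successively A p"
  unfolding dipath_def successively_conv_nth by auto

lemma dipath_Cons:
  assumes "dipath W A p" "v \<in> W" "v \<notin> set p" "A v (hd p)"
  shows "dipath W A (v # p)"
  using assms unfolding dipath_iff by (auto simp: successively_Cons)

lemma dipath_drop:
  assumes "dipath W A p" "n < length p"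
  shows "dipath W A (drop n p)"
proof -
  have "successively A (take n p @ drop n p)" using assms by (simp add: dipath_iff)
  then have "successively A (drop n p)" unfolding successively_append_iff by blast
  then show ?thesis using assms unfolding dipath_iff by (auto dest: in_set_dropD)
qed

text \<open>Routes are assembled as reachability, so consecutive pieces of one route may overlap; a
  path is extracted only at the very end. Reflexivity holds even outside \<open>W\<close>.\<close>

definition reach :: "('a \<Rightarrow> 'a \<Rightarrow> bool) \<Rightarrow> 'a set \<Rightarrow> 'a \<Rightarrow> 'a \<Rightarrow> bool" where
  "reach A W u v \<longleftrightarrow> (u, v) \<in> {(a, b). a \<in> W \<and> b \<in> W \<and> A a b}\<^sup>*"

lemma reach_refl [simp]: "reach A W u u"
  by (simp add: reach_def)

lemma reach_trans: "reach A W u v \<Longrightarrow> reach A W v w \<Longrightarrow> reach A W u w"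
  unfolding reach_def by (rule rtrancl_trans)

lemma reach_mono: "reach A W u v \<Longrightarrow> W \<subseteq> W' \<Longrightarrow> reach A W' u v"
  unfolding reach_def by (rule subsetD[OF rtrancl_mono]) auto

lemma reach_step: "A u v \<Longrightarrow> u \<in> W \<Longrightarrow> v \<in> W \<Longrightarrow> reach A W u v"
  unfolding reach_def by (rule r_into_rtrancl) simp

text \<open>Prepend the vertices one by one; if the new vertex already lies on the path, discard
  everything before it instead.\<close>

lemma reach_imp_dipath:
  assumes "reach A W u v" "v \<in> W"
  shows "\<exists>p. dipath_from_to W A p u v"
  using assms(1) unfolding reach_def
proof (induction rule: converse_rtrancl_induct)
  case base
  have "dipath_from_to W A [v] v v" using assms by (auto simp: dipath_from_to_def dipath_def)
  then show ?case by blast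
next
  case (step u z)
  then obtain p where p: "dipath W A p" "hd p = z" "last p = v" unfolding dipath_from_to_def by blast
  show ?case
  proof (cases "u \<in> set p")
    case True
    then obtain n where n: "n < length p" "p ! n = u" by (auto simp: in_set_conv_nth)
    then have "dipath_from_to W A (drop n p) u v"
      using p dipath_drop[OF p(1) n(1)] by (simp add: dipath_from_to_def hd_drop_conv_nth)
    then show ?thesis by blast
  next
    case False
    then have "dipath_from_to W A (u # p) u v"
      using p step dipath_Cons[of W A p u] by (auto simp: dipath_from_to_def dipath_iff)
    then show ?thesis by blast
  qed
qed

lemma dipath_imp_reach:
  assumes "dipath W A p" shows "reach A (set p) (hd p) (last p)"
  using assms
proof (induction p)
  case (Cons a p)
  show ?case
  proof (cases "p = []")
    case False
    then have d: "dipath W A p" and a: "A a (hd p)" using Cons.prems by (auto simp: dipath_iff successively_Cons)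
    have "reach A (set (a # p)) (hd p) (last p)" using Cons.IH[OF d] by (rule reach_mono) auto
    moreover have "reach A (set (a # p)) a (hd p)" using a False by (intro reach_step) auto
    ultimately show ?thesis using False by (auto intro: reach_trans)
  qed simp
qed (simp add: dipath_def)

text \<open>Enlarge the set one element at a time by a minimiser of \<open>f\<close> among the
  remaining elements.\<close>

lemma obtain_lowest:
  fixes f :: "'a \<Rightarrow> nat"
  assumes "finite U" "m \<le> card U"
  shows "\<exists>L\<subseteq>U. card L = m \<and> (\<forall>l\<in>L. \<forall>u\<in>U - L. f l \<le> f u)"
  using assms(2)
proof (induction m)
  case 0 then show ?case by (intro exI[of _ "{}"]) auto
next
  case (Suc m)
  then obtain L where L: "L \<subseteq> U" "card L = m" "\<forall>l\<in>L. \<forall>u\<in>U - L. f l \<le> f u" by auto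
  have "U - L \<noteq> {}" using L Suc.prems by (metis Diff_eq_empty_iff Suc_n_not_le_n subset_antisym)
  then obtain v where v: "v \<in> U - L" "\<forall>u\<in>U - L. f v \<le> f u"
    using ex_has_least_nat[of "\<lambda>u. u \<in> U - L" _ f] by blast
  have fL: "finite L" using L(1) assms(1) finite_subset by blast
  show ?case by (rule exI[of _ "insert v L"]) (use L v fL in auto)
qed

section \<open>Degree counting in finite tournaments\<close>

locale finite_tournament =
  fixes V :: "'a set" and A :: "'a \<Rightarrow> 'a \<Rightarrow> bool"
  assumes tournament: "tournament V A"
begin

abbreviation N :: "'a \<Rightarrow> 'a set" where "N v \<equiv> {u. A v u}"

lemma finite_V: "finite V" using tournament unfolding tournament_def by blast
lemma arc_in: "A u v \<Longrightarrow> u \<in> V \<and> v \<in> V" using tournament unfolding tournament_def by blast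
lemma irrefl [simp]: "\<not> A v v" using tournament unfolding tournament_def by blast
lemma arc_total: "u \<in> V \<Longrightarrow> v \<in> V \<Longrightarrow> u \<noteq> v \<Longrightarrow> \<not> A u v \<Longrightarrow> A v u"
  using tournament unfolding tournament_def by blast
lemma arc_asym: "A u v \<Longrightarrow> \<not> A v u"
  using arc_in[of u v] irrefl[of u] tournament unfolding tournament_def by metis
lemma finite_sub: "C \<subseteq> V \<Longrightarrow> finite C" using finite_V by (rule rev_finite_subset)
lemma N_sub: "N v \<subseteq> V" using arc_in by auto
lemma finite_N [simp]: "finite (N v)" using N_sub by (rule finite_sub)

text \<open>Adding the double sum of arc indicators to its transpose counts every ordered pair of
  distinct vertices exactly once.\<close>

lemma sum_out_degrees:
  assumes C: "C \<subseteq> V"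
  shows "2 * (\<Sum>c\<in>C. card (N c \<inter> C)) = card C * (card C - 1)"
proof -
  have fC: "finite C" using C by (rule finite_sub)
  have "(\<Sum>c\<in>C. card (N c \<inter> C)) = (\<Sum>c\<in>C. \<Sum>b\<in>C. of_bool (A c b))"
    by (intro sum.cong) (use fC in \<open>auto simp: Int_commute\<close>)
  moreover have "(\<Sum>c\<in>C. \<Sum>b\<in>C. of_bool (A c b)) = (\<Sum>c\<in>C. \<Sum>b\<in>C. of_bool (A b c) :: nat)"
    by (rule sum.swap)
  ultimately have "2 * (\<Sum>c\<in>C. card (N c \<inter> C)) = (\<Sum>c\<in>C. \<Sum>b\<in>C. of_bool (A c b) + of_bool (A b c))"
    by (simp add: sum.distrib)
  also have "\<dots> = (\<Sum>c\<in>C. \<Sum>b\<in>C. of_bool (b \<noteq> c))"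
  proof (intro sum.cong refl)
    fix c b assume "c \<in> C" "b \<in> C"
    then show "of_bool (A c b) + of_bool (A b c) = (of_bool (b \<noteq> c) :: nat)"
      using C arc_total[of c b] arc_asym[of c b] by (cases "b = c") (auto simp: of_bool_def)
  qed
  also have "\<dots> = (\<Sum>c\<in>C. card C - 1)"
  proof (rule sum.cong)
    fix c assume c: "c \<in> C"
    have "(\<Sum>b\<in>C. of_bool (b \<noteq> c)) = card (C - {c})"
      using fC by (simp add: set_diff_eq Int_def)
    then show "(\<Sum>b\<in>C. of_bool (b \<noteq> c)) = card C - 1" using c by simp
  qed simp
  finally show ?thesis by simp
qed

text \<open>Averaging: the mean out-degree inside \<open>C\<close> is (card C - 1)/2. The next lemma
  uses the same mean from the other side.\<close>

lemma ex_low_out_degree: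
  assumes "C \<subseteq> V" "C \<noteq> {}"
  shows "\<exists>c\<in>C. 2 * card (N c \<inter> C) < card C"
proof (rule ccontr)
  assume "\<not> ?thesis"
  then have "(\<Sum>c\<in>C. card C) \<le> (\<Sum>c\<in>C. 2 * card (N c \<inter> C))" by (intro sum_mono) auto
  then have "card C * card C \<le> card C * (card C - 1)"
    using sum_out_degrees[OF assms(1)] by (simp add: sum_distrib_left)
  moreover have "card C > 0" using assms finite_sub card_gt_0_iff by blast
  ultimately show False by simp
qed

lemma ex_high_out_degree:
  assumes "C \<subseteq> V" "C \<noteq> {}"
  shows "\<exists>c\<in>C. card C \<le> Suc (2 * card (N c \<inter> C))"
proof (rule ccontr)
  assume *: "\<not> ?thesis"
  have pos: "card C > 0" using assms finite_sub card_gt_0_iff by blast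
  have "(\<Sum>c\<in>C. 2 * card (N c \<inter> C)) < (\<Sum>c\<in>C. card C - 1)"
    using * pos assms(2) by (intro sum_strict_mono) (auto simp: not_le card_gt_0_iff)
  then show False
    using sum_out_degrees[OF assms(1)] by (simp add: sum_distrib_left)
qed

text \<open>If neither kind of short route exists, all unblocked out-neighbours of C, and C itself, are
  out-neighbours of t; a vertex of C with small out-degree inside C then has smaller out-degree than t.\<close>
lemma short_link:
  assumes C: "C \<subseteq> V - X - F" "C \<noteq> {}" "t \<notin> C" and t: "t \<in> V"
    and deg: "\<And>c. c \<in> C \<Longrightarrow> card (N t - X) \<le> card (N c - X)"
    and blocked: "\<And>c. c \<in> C \<Longrightarrow> card (N c \<inter> F - X) \<le> b"
    and large: "2 * b \<le> card C"
  shows "\<exists>c\<in>C. A c t \<or> (\<exists>z. A c z \<and> A z t \<and> z \<notin> X \<union> F)"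
proof (rule ccontr)
  assume no: "\<not> ?thesis"
  let ?M = "N t - X - F"
  have CM: "C \<subseteq> ?M" using C t no arc_total by blast
  obtain c where c: "c \<in> C" "2 * card (N c \<inter> C) < card C"
    using ex_low_out_degree[of C] C by blast
  \<comment> \<open>An out-neighbour of \<open>c\<close> is neither \<open>t\<close> nor, when
    outside \<open>X\<close> and \<open>F\<close>, a vertex dominating \<open>t\<close>; in the
    latter case \<open>t\<close> therefore dominates it.\<close>
  have "N c - X \<subseteq> (N c \<inter> C) \<union> (?M - C) \<union> (N c \<inter> F - X)"
    using no c(1) t arc_total arc_in by blast
  then have "card (N c - X) \<le> card ((N c \<inter> C) \<union> (?M - C) \<union> (N c \<inter> F - X))"
    by (intro card_mono) auto
  also have "\<dots> \<le> card (N c \<inter> C) + card (?M - C) + card (N c \<inter> F - X)"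
    by (meson add_le_mono1 card_Un_le order_trans)
  also have "card (?M - C) = card ?M - card C" using CM by (intro card_Diff_subset finite_subset[OF CM]) auto
  finally have "card (N c - X) \<le> card (N c \<inter> C) + (card ?M - card C) + b" using blocked[OF c(1)] by linarith
  moreover have "card C \<le> card ?M" using CM by (intro card_mono) auto
  moreover have "card ?M \<le> card (N t - X)" by (intro card_mono) auto
  \<comment> \<open>Fewer than half of \<open>card C\<close> out-neighbours lie in \<open>C\<close>
    and \<open>b\<close> is at most the other half, so together they do not make up for the
    subtracted \<open>card C\<close>.\<close>
  ultimately show False using deg[OF c(1)] c(2) large by linarith
qed

text \<open>Repeatedly remove a vertex of large out-degree in what is left. Indices run backwards:
  \<open>f j\<close> is chosen among q + j + 1 vertices, hence has out-degree at least (q + j)/2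
  there, and loses at most \<open>j\<close> out-neighbours to the \<open>j\<close> later
  choices.\<close>

lemma greedy_entries:
  assumes "Q \<subseteq> V" "card Q = q + r"
  shows "\<exists>f. inj_on f {..<r} \<and> f ` {..<r} \<subseteq> Q \<and>
     (\<forall>j<r. q \<le> 2 * card (N (f j) \<inter> (Q - f ` {..<r})) + j)"
  using assms
proof (induction r arbitrary: Q)
  case 0 then show ?case by simp
next
  case (Suc r)
  have fQ: "finite Q" using Suc.prems(1) by (rule finite_sub)
  obtain e where e: "e \<in> Q" "card Q \<le> Suc (2 * card (N e \<inter> Q))"
  proof -
    have "Q \<noteq> {}" using Suc.prems(2) by auto
    then show thesis using ex_high_out_degree[OF Suc.prems(1)] that by blast
  qed
  have "card (Q - {e}) = q + r" using e Suc.prems by simp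
  then obtain f where f: "inj_on f {..<r}" "f ` {..<r} \<subseteq> Q - {e}"
    "\<forall>j<r. q \<le> 2 * card (N (f j) \<inter> (Q - {e} - f ` {..<r})) + j"
    using Suc.IH[of "Q - {e}"] Suc.prems by blast
  let ?g = "f(r := e)"
  have im: "?g ` {..<Suc r} = insert e (f ` {..<r})"
    by (auto simp: lessThan_Suc)
  have Q': "Q - ?g ` {..<Suc r} = Q - {e} - f ` {..<r}" unfolding im by auto
  have "N e \<inter> Q \<subseteq> (N e \<inter> (Q - {e} - f ` {..<r})) \<union> f ` {..<r}" by auto
  then have "card (N e \<inter> Q) \<le> card (N e \<inter> (Q - {e} - f ` {..<r})) + card (f ` {..<r})"
    by (meson card_Un_le card_mono finite_Int finite_N finite_UnI finite_imageI finite_lessThan order_trans)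
  also have "card (f ` {..<r}) \<le> r" using card_image_le[of "{..<r}" f] by simp
  finally have "q \<le> 2 * card (N e \<inter> (Q - {e} - f ` {..<r})) + r" using e(2) Suc.prems(2) by linarith
  then have "\<forall>j<Suc r. q \<le> 2 * card (N (?g j) \<inter> (Q - ?g ` {..<Suc r})) + j"
    unfolding Q' using f(3) by (auto simp: less_Suc_eq)
  moreover have "inj_on ?g {..<r}" using f(1) by (rule inj_on_cong[THEN iffD1, rotated]) auto
  then have "inj_on ?g {..<Suc r}" using f(2) by (auto simp: lessThan_Suc)
  moreover have "?g ` {..<Suc r} \<subseteq> Q" unfolding im using f(2) e(1) by auto
  ultimately show ?case by blast
qed

text \<open>The margin k + i lets entry number i lose \<open>k\<close> out-neighbours to the first
  vertices of the linking paths and i more to the representatives chosen before. Vertices of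
  out-degree above 4k in \<open>L\<close> are kept out of \<open>S\<close>; they are few and serve
  as entries themselves.\<close>

lemma entries:
  assumes L: "L \<subseteq> V" "card L = 5 * k"
  shows "\<exists>e S. inj_on e {..<k} \<and> e ` {..<k} \<subseteq> L \<and> S \<subseteq> L \<and> e ` {..<k} \<inter> S = {} \<and>
    (\<forall>i<k. k + i < card (N (e i) \<inter> S)) \<and> (\<forall>v\<in>S. card (N v \<inter> L) \<le> 4 * k)"
proof -
  define H where "H = {v\<in>L. 4 * k < card (N v \<inter> L)}"
  have fL: "finite L" using L(1) by (rule finite_sub)
  have HL: "H \<subseteq> L" by (auto simp: H_def)
  have fH: "finite H" using finite_subset[OF HL fL] .
  \<comment> \<open>A vertex of \<open>H\<close> with below-average out-degree inside
    \<open>H\<close> still has more than 4k out-neighbours in \<open>L\<close>, so the 5k - card H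
    vertices outside \<open>H\<close> must supply most of them; this bounds
    \<open>H\<close>.\<close>
  have h: "card H + 3 \<le> 2 * k" if ne: "H \<noteq> {}"
  proof -
    obtain v where v: "v \<in> H" "2 * card (N v \<inter> H) < card H"
      using ex_low_out_degree[of H] ne HL L by blast
    have "card (N v \<inter> L) \<le> card ((N v \<inter> H) \<union> (L - H))" using fL fH by (intro card_mono) auto
    also have "\<dots> \<le> card (N v \<inter> H) + card (L - H)" by (rule card_Un_le)
    also have "card (L - H) = card L - card H" using HL fH by (simp add: card_Diff_subset)
    finally have "card (N v \<inter> L) \<le> card (N v \<inter> H) + (card L - card H)" .
    moreover have "card H \<le> card L" using HL fL by (simp add: card_mono)
    moreover have "4 * k < card (N v \<inter> L)" using v(1) by (simp add: H_def)
    ultimately show ?thesis using v(2) L(2) by arith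
  qed
  have lost: "4 * k < card (N v \<inter> S) + card (E - {v})" if "v \<in> H" "S = L - E" "finite E" for v S E
  proof -
    have "card (N v \<inter> L) \<le> card ((N v \<inter> S) \<union> (E - {v}))"
      using that fL by (intro card_mono) auto
    also have "\<dots> \<le> card (N v \<inter> S) + card (E - {v})" by (rule card_Un_le)
    finally show ?thesis using that(1) by (simp add: H_def)
  qed
  show ?thesis
  proof (cases "k \<le> card H")
    case True
    then obtain E where E: "E \<subseteq> H" "card E = k" by (meson obtain_subset_with_card_n)
    then obtain e where e: "bij_betw e {..<k} E"
      by (metis card_lessThan fH finite_lessThan finite_same_card_bij finite_subset)
    have "k + i < card (N (e i) \<inter> (L - H))" if "i < k" for i
    proof -
      have "e i \<in> H" using e E that by (auto simp: bij_betw_def)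
      then have "4 * k < card (N (e i) \<inter> (L - H)) + (card H - 1)" "card H + 3 \<le> 2 * k"
        using lost[of "e i" "L - H" H] h fH by (auto simp: card_Diff_singleton)
      then show ?thesis using that by arith
    qed
    moreover have "\<forall>v\<in>L - H. card (N v \<inter> L) \<le> 4 * k" by (auto simp: H_def)
    moreover have "e ` {..<k} \<inter> (L - H) = {}" "e ` {..<k} \<subseteq> L" using e E HL by (auto simp: bij_betw_def)
    ultimately show ?thesis using e by (intro exI[of _ e] exI[of _ "L - H"]) (auto simp: bij_betw_def)
  next
    case False
    let ?r = "k - card H"
    have "card (L - H) = 4 * k + ?r" using L(2) HL fH False by (simp add: card_Diff_subset)
    then obtain f where f: "inj_on f {..<?r}" "f ` {..<?r} \<subseteq> L - H"
      "\<forall>j<?r. 4 * k \<le> 2 * card (N (f j) \<inter> (L - H - f ` {..<?r})) + j"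
      using greedy_entries[of "L - H" "4 * k" ?r] L(1) by blast
    obtain g where g: "bij_betw g {..<card H} H"
      by (metis card_lessThan fH finite_lessThan finite_same_card_bij)
    \<comment> \<open>All of \<open>H\<close> is used first and the greedy choices fill up.
      Reversing their order makes the guaranteed out-degree grow with the index, as the requirement
      k + i does.\<close>
    define e where "e i = (if i < card H then g i else f (k - 1 - i))" for i
    define E where "E = H \<union> f ` {..<?r}"
    define S where "S = L - E"
    have fE: "finite E" using fH by (simp add: E_def)
    have gH: "g i \<in> H" if "i < card H" for i using g that by (auto simp: bij_betw_def)
    have fr: "f (k - 1 - i) \<in> f ` {..<?r}" "k - 1 - i < ?r" if "i < k" "\<not> i < card H" for i
      using that by auto
    have cE: "card E \<le> k"
      using card_Un_le[of H "f ` {..<?r}"] card_image_le[of "{..<?r}" f] False unfolding E_def by simp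
    have eE: "e i \<in> E" if "i < k" for i using gH fr that unfolding e_def E_def by auto
    have eH: "e i \<in> H \<longleftrightarrow> i < card H" if "i < k" for i
      using gH[of i] subsetD[OF f(2) fr(1)[OF that]] by (auto simp: e_def)
    have inj: "inj_on e {..<k}"
    proof (rule inj_onI)
      fix i j assume ij: "i \<in> {..<k}" "j \<in> {..<k}" "e i = e j"
      show "i = j"
      proof (cases "i < card H \<longleftrightarrow> j < card H")
        case True
        show ?thesis
        proof (cases "i < card H")
          case i: True
          then have "g i = g j" using ij True by (simp add: e_def)
          then show ?thesis using g i True by (auto simp: bij_betw_def inj_on_def)
        next
          case i: False
          then have "f (k - 1 - i) = f (k - 1 - j)" using ij True by (simp add: e_def)
          then have "k - 1 - i = k - 1 - j" using f(1) fr(2) i True ij by (auto simp: inj_on_def)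
          then show ?thesis using ij by auto
        qed
      next
        case False
        then show ?thesis using ij eH by (metis lessThan_iff)
      qed
    qed
    have "k + i < card (N (e i) \<inter> S)" if i: "i < k" for i
    proof (cases "i < card H")
      case True
      have "card (E - {g i}) \<le> k - 1"
        using gH[OF True] cE fE by (auto simp: E_def card_Diff_singleton)
      then show ?thesis using lost[OF gH[OF True] S_def fE] True i by (simp add: e_def)
    next
      case c: False
      have "S = L - H - f ` {..<?r}" by (auto simp: S_def E_def)
      then have "4 * k \<le> 2 * card (N (e i) \<inter> S) + (k - 1 - i)" using f(3) fr(2)[OF i c] c
        by (simp add: e_def)
      then show ?thesis using i by linarith
    qed
    moreover have "\<forall>v\<in>S. card (N v \<inter> L) \<le> 4 * k" by (auto simp: S_def E_def H_def)
    moreover have "e ` {..<k} \<inter> S = {}" "e ` {..<k} \<subseteq> L" "S \<subseteq> L"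
      using eE f(2) HL by (auto simp: S_def E_def)
    ultimately show ?thesis using inj by (intro exI[of _ e] exI[of _ S]) auto
  qed
qed

end

section \<open>Shortest linkages\<close>

text \<open>Choose greedily: when \<open>M i\<close> is reached only i elements are taken, fewer
  than it has.\<close>

lemma distinct_representatives:
  fixes M :: "nat \<Rightarrow> 'a set"
  assumes "\<And>i. i < k \<Longrightarrow> i < card (M i)"
  shows "\<exists>l. inj_on l {..<k} \<and> (\<forall>i<k. l i \<in> M i)"
  using assms
proof (induction k)
  case (Suc k)
  then obtain l where l: "inj_on l {..<k}" "\<forall>i<k. l i \<in> M i" by auto
  have "card (l ` {..<k}) < card (M k)"
    using Suc.prems[of k] card_image_le[of "{..<k}" l] by simp
  then have "\<not> M k \<subseteq> l ` {..<k}" using card_mono[of "l ` {..<k}" "M k"] by auto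
  then obtain v where v: "v \<in> M k" "v \<notin> l ` {..<k}" by auto
  have "inj_on (l(k := v)) {..<k}" using l(1) by (rule inj_on_cong[THEN iffD1, rotated]) auto
  then have "inj_on (l(k := v)) {..<Suc k}" using v(2) by (auto simp: lessThan_Suc)
  moreover have "\<forall>i<Suc k. (l(k := v)) i \<in> M i" using l(2) v(1) by (auto simp: less_Suc_eq)
  ultimately show ?case by blast
qed simp

text \<open>Only the ends are prescribed by index; the starts may be any vertices of
  \<open>S\<close>, since Menger's theorem gives no control over the pairing.\<close>

definition linkage :: "('a \<Rightarrow> 'a \<Rightarrow> bool) \<Rightarrow> 'a set \<Rightarrow> 'a set \<Rightarrow> (nat \<Rightarrow> 'a) \<Rightarrow> nat \<Rightarrow> (nat \<Rightarrow> 'a list) \<Rightarrow> bool" where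
  "linkage A G S ys k P \<longleftrightarrow>
     (\<forall>j<k. dipath G A (P j) \<and> hd (P j) \<in> S \<and> last (P j) = ys j) \<and>
     (\<forall>i<k. \<forall>j<k. i \<noteq> j \<longrightarrow> set (P i) \<inter> set (P j) = {})"

text \<open>Fewer than \<open>k\<close> vertices miss some source and some target, and strong
  connectivity joins these two around them; so no small separator exists and Menger's theorem
  applies.\<close>

lemma linkage_exists:
  assumes fin: "finite G" and S: "S \<subseteq> G" "k \<le> card S"
    and ys: "inj_on ys {..<k}" "ys ` {..<k} \<subseteq> G"
    and strong: "\<And>Z. Z \<subseteq> G \<Longrightarrow> card Z < k \<Longrightarrow> strongly_connected (G - Z) A"
  shows "\<exists>P. linkage A G S ys k P"
proof -
  define R where "R = {(u, v). u \<in> G \<and> v \<in> G \<and> A u v}"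
  have fR: "finite R" by (rule finite_subset[of _ "G \<times> G"]) (use fin in \<open>auto simp: R_def\<close>)
  have fS: "finite S" using S(1) fin by (rule finite_subset)
  have "k \<le> card Z" if Z: "finite Z" "separates R S (ys ` {..<k}) Z" for Z
  proof (rule ccontr)
    assume "\<not> k \<le> card Z"
    then have less: "card Z < k" by simp
    have "card (ys ` {..<k}) = k" using ys(1) by (simp add: card_image)
    then have "\<not> S \<subseteq> Z" "\<not> ys ` {..<k} \<subseteq> Z"
      using card_mono[OF Z(1), of S] card_mono[OF Z(1), of "ys ` {..<k}"] S(2) less by linarith+
    then obtain s y where sy: "s \<in> S - Z" "y \<in> ys ` {..<k} - Z" by blast
    show False
    proof (cases "s = y")
      case True
      then have "walk R [s]" by (simp add: walk_def)
      then show False using Z(2) sy True unfolding separates_def by fastforce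
    next
      case False
      have "card (Z \<inter> G) < k" using card_mono[OF Z(1), of "Z \<inter> G"] less by auto
      then have "strongly_connected (G - Z \<inter> G) A" by (intro strong) auto
      then obtain p where p: "dipath (G - Z \<inter> G) A p" "hd p = s" "last p = y"
        using sy False S(1) ys(2) unfolding strongly_connected_def dipath_from_to_def by blast
      then have "p \<noteq> []" "successively A p" "set p \<subseteq> G" by (auto simp: dipath_iff)
      then have "walk R p" unfolding walk_def R_def by (auto elim!: successively_mono)
      moreover have "set p \<inter> Z = {}" using p(1) unfolding dipath_iff by auto
      ultimately show False using Z(2) sy p(2,3) unfolding separates_def by auto
    qed
  qed
  then obtain \<P> where P: "disjoint_paths R S (ys ` {..<k}) \<P>" "card \<P> = k"
    using menger[OF fR fS] by blast
  have "\<forall>j\<in>{..<k}. \<exists>p\<in>\<P>. last p = ys j"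
    using disjoint_paths_last_surj[OF P(1)] P(2) ys(1) by (auto simp: card_image)
  then obtain p where p: "\<And>j. j < k \<Longrightarrow> p j \<in> \<P> \<and> last (p j) = ys j" by (metis lessThan_iff)
  have "dipath G A (p j) \<and> hd (p j) \<in> S \<and> last (p j) = ys j" if "j < k" for j
  proof -
    have w: "walk R (p j)" "distinct (p j)" "hd (p j) \<in> S"
      using p[OF that] P(1) unfolding disjoint_paths_def by auto
    \<comment> \<open>Every arc of \<open>R\<close> stays in \<open>G\<close>; a one-vertex walk has
      no arc, so its membership comes from the start.\<close>
    have "set q \<subseteq> G \<and> successively A q" if "walk R q" "hd q \<in> G" for q
      using that by (induction q rule: induct_list012) (auto simp: walk_def R_def)
    then have "set (p j) \<subseteq> G \<and> successively A (p j)" using w S(1) by blast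
    then show ?thesis using w p[OF that] by (auto simp: dipath_iff walk_def)
  qed
  moreover have "set (p i) \<inter> set (p j) = {}" if "i < k" "j < k" "i \<noteq> j" for i j
  proof -
    have "p i \<noteq> p j" using p[OF that(1)] p[OF that(2)] ys(1) that by (metis inj_on_def lessThan_iff)
    then show ?thesis using p that P(1) unfolding disjoint_paths_def by blast
  qed
  ultimately show ?thesis unfolding linkage_def by blast
qed

text \<open>Minimise the total length: exchanging a single path for another one disjoint from the
  rest gives a competing linkage that differs in one summand.\<close>

lemma shortest_linkage_exists:
  assumes "linkage A G S ys k P0"
  shows "\<exists>P. linkage A G S ys k P \<and> (\<forall>j<k. \<forall>q. dipath G A q \<longrightarrow> hd q \<in> S \<longrightarrow> last q = ys j \<longrightarrow>
           (\<forall>i<k. i \<noteq> j \<longrightarrow> set q \<inter> set (P i) = {}) \<longrightarrow> length (P j) \<le> length q)"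
proof -
  obtain P where P: "linkage A G S ys k P"
    and least: "\<And>Q. linkage A G S ys k Q \<Longrightarrow> (\<Sum>j<k. length (P j)) \<le> (\<Sum>j<k. length (Q j))"
    using ex_has_least_nat[of "linkage A G S ys k" P0 "\<lambda>P. \<Sum>j<k. length (P j)"] assms by blast
  have "length (P j) \<le> length q"
    if j: "j < k" and q: "dipath G A q" "hd q \<in> S" "last q = ys j"
      "\<forall>i<k. i \<noteq> j \<longrightarrow> set q \<inter> set (P i) = {}" for j q
  proof -
    have "linkage A G S ys k (P(j := q))"
      using P q unfolding linkage_def by (auto simp: Int_commute)
    from least[OF this] have "(\<Sum>i<k. length (P i)) \<le> (\<Sum>i<k. length ((P(j := q)) i))" .
    moreover have "(\<Sum>i<k. length (Q i)) = length (Q j) + (\<Sum>i\<in>{..<k} - {j}. length (Q i))" for Q :: "nat \<Rightarrow> 'a list"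
      using j by (intro sum.remove) auto
    moreover have "(\<Sum>i\<in>{..<k} - {j}. length ((P(j := q)) i)) = (\<Sum>i\<in>{..<k} - {j}. length (P i))"
      by (intro sum.cong) auto
    ultimately show ?thesis by simp
  qed
  then show ?thesis using P by blast
qed

locale shortest_linkage =
  fixes A :: "'a \<Rightarrow> 'a \<Rightarrow> bool" and G S :: "'a set" and ys :: "nat \<Rightarrow> 'a" and k :: nat and P :: "nat \<Rightarrow> 'a list"
  assumes linkage: "linkage A G S ys k P"
    and shortest_all: "\<forall>j<k. \<forall>q. dipath G A q \<longrightarrow> hd q \<in> S \<longrightarrow> last q = ys j \<longrightarrow>
      (\<forall>i<k. i \<noteq> j \<longrightarrow> set q \<inter> set (P i) = {}) \<longrightarrow> length (P j) \<le> length q"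
    and S_sub: "S \<subseteq> G"
begin

lemma shortest:
  assumes "j < k" "dipath G A q" "hd q \<in> S" "last q = ys j"
    "\<And>i. i < k \<Longrightarrow> i \<noteq> j \<Longrightarrow> set q \<inter> set (P i) = {}"
  shows "length (P j) \<le> length q"
  using shortest_all assms by blast

lemma path: "j < k \<Longrightarrow> dipath G A (P j)" "j < k \<Longrightarrow> hd (P j) \<in> S" "j < k \<Longrightarrow> last (P j) = ys j"
  "i < k \<Longrightarrow> j < k \<Longrightarrow> i \<noteq> j \<Longrightarrow> set (P i) \<inter> set (P j) = {}"
  using linkage unfolding linkage_def by auto

text \<open>Starting at a later vertex of \<open>S\<close> would shorten the path.\<close>

lemma path_inter_sources:
  assumes j: "j < k"
  shows "set (P j) \<inter> S \<subseteq> {hd (P j)}"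
proof
  fix v assume v: "v \<in> set (P j) \<inter> S"
  then obtain n where n: "n < length (P j)" "P j ! n = v" by (auto simp: in_set_conv_nth)
  have "length (P j) \<le> length (drop n (P j))"
  proof (rule shortest[OF j dipath_drop[OF path(1)[OF j] n(1)]])
    show "set (drop n (P j)) \<inter> set (P i) = {}" if "i < k" "i \<noteq> j" for i
      using path(4)[OF that(1) j that(2)] set_drop_subset[of n "P j"] by blast
  qed (use v n path(3)[OF j] in \<open>auto simp: hd_drop_conv_nth\<close>)
  then have "n = 0" using n(1) by simp
  then show "v \<in> {hd (P j)}" using n by (auto simp: hd_conv_nth)
qed

text \<open>Entering \<open>P j\<close> from \<open>l\<close> at position n trades n vertices for
  one, so minimality gives n < 2. That \<open>l\<close> is off all paths keeps the competitor
  disjoint from the others.\<close>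

lemma out_neighbours_of_unused_source:
  assumes j: "j < k" and l: "l \<in> S" "\<And>i. i < k \<Longrightarrow> l \<notin> set (P i)"
  shows "{u. A l u} \<inter> set (P j) \<subseteq> set (take 2 (P j))"
proof
  fix v assume v: "v \<in> {u. A l u} \<inter> set (P j)"
  then obtain n where n: "n < length (P j)" "P j ! n = v" by (auto simp: in_set_conv_nth)
  have "dipath G A (l # drop n (P j))"
    using v l j S_sub n set_drop_subset[of n "P j"]
    by (intro dipath_Cons dipath_drop path(1)) (auto simp: hd_drop_conv_nth)
  then have "length (P j) \<le> length (l # drop n (P j))"
  proof (rule shortest[OF j])
    show "set (l # drop n (P j)) \<inter> set (P i) = {}" if "i < k" "i \<noteq> j" for i
      using path(4)[OF that(1) j that(2)] l(2)[OF that(1)] set_drop_subset[of n "P j"] by auto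
  qed (use l n path(3)[OF j] in auto)
  then have "n < 2" using n(1) by simp
  then show "v \<in> set (take 2 (P j))" using n by (auto simp: in_set_conv_nth intro!: exI[of _ n])
qed

text \<open>The shortcut now costs the two vertices \<open>l\<close> and \<open>c\<close>, so it may
  enter \<open>P j\<close> only at a position n < 3.\<close>

lemma out_neighbours_at_distance_two:
  assumes j: "j < k" and l: "l \<in> S" "\<And>i. i < k \<Longrightarrow> l \<notin> set (P i)"
    and c: "A l c" "l \<noteq> c" "c \<in> G" "\<And>i. i < k \<Longrightarrow> c \<notin> set (P i)"
  shows "{u. A c u} \<inter> set (P j) \<subseteq> set (take 3 (P j))"
proof
  fix v assume v: "v \<in> {u. A c u} \<inter> set (P j)"
  then obtain n where n: "n < length (P j)" "P j ! n = v" by (auto simp: in_set_conv_nth)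
  have "dipath G A (l # c # drop n (P j))"
    using v l c j S_sub n set_drop_subset[of n "P j"]
    by (intro dipath_Cons dipath_drop path(1)) (auto simp: hd_drop_conv_nth)
  then have "length (P j) \<le> length (l # c # drop n (P j))"
  proof (rule shortest[OF j])
    show "set (l # c # drop n (P j)) \<inter> set (P i) = {}" if "i < k" "i \<noteq> j" for i
      using path(4)[OF that(1) j that(2)] l(2)[OF that(1)] c(4)[OF that(1)]
        set_drop_subset[of n "P j"] by auto
  qed (use l n path(3)[OF j] in auto)
  then have "n < 3" using n(1) by simp
  then show "v \<in> set (take 3 (P j))" using n by (auto simp: in_set_conv_nth intro!: exI[of _ n])
qed

end

section \<open>Short routes into and out of the low-degree set\<close>

context finite_tournament
begin

definition "deg X v = card (N v - X)"

text \<open>Apply \<open>short_link\<close> to the permitted out-neighbours of \<open>x\<close>.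
  They lie outside \<open>L\<close>, so their \<open>deg\<close> is at least that of
  \<open>t\<close>, and \<open>D\<close> collects the one or two intermediate vertices.\<close>

lemma entry_path:
  assumes k: "1 \<le> k" and X: "X \<subseteq> V" "card X = k" "x \<in> X" and Y: "card Y = k"
    and L: "L \<subseteq> V - X - Y" "card L = 5 * k" "t \<in> L"
    and low: "\<And>l u. l \<in> L \<Longrightarrow> u \<in> V - X - Y - L \<Longrightarrow> deg X l \<le> deg X u"
    and F: "card F + 2 \<le> 2 * k"
    and out: "28 * k - 13 \<le> card (N x)"
    and fin: "finite Y" "finite F"
  shows "\<exists>D \<subseteq> V - X - Y - L - F. card D \<le> 2 \<and> reach A (D \<union> {x, t}) x t"
proof (cases "A x t")
  case True
  then show ?thesis by (intro exI[of _ "{}"]) (auto intro: reach_step)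
next
  case False
  let ?F = "Y \<union> (L - {t}) \<union> F"
  let ?C = "N x - X - ?F"
  have fX: "finite X" and fL: "finite L" using X L finite_sub by blast+
  have "card ?F \<le> card Y + card (L - {t}) + card F"
    by (meson add_le_mono1 card_Un_le order_trans)
  \<comment> \<open>The three parts contribute k, 5k - 1 and 2k - 2.\<close>
  then have cF: "card ?F \<le> 8 * k - 3" using Y L(2,3) fL F k by (simp add: card_Diff_singleton)
  \<comment> \<open>As \<open>x\<close> is not its own out-neighbour, \<open>X\<close> costs only k
    - 1. At least 19k - 9 candidates remain, enough for the 2(8k - 3) that \<open>short_link\<close>
    asks for.\<close>
  have "N x \<subseteq> ?C \<union> (X - {x}) \<union> ?F" by auto
  then have "card (N x) \<le> card (?C \<union> (X - {x}) \<union> ?F)"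
    using fX fL fin by (intro card_mono) auto
  also have "\<dots> \<le> card ?C + card (X - {x}) + card ?F"
    by (meson add_le_mono1 card_Un_le order_trans)
  finally have cC: "28 * k - 13 \<le> card ?C + (k - 1) + (8 * k - 3)"
    using cF out X fX by (simp add: card_Diff_singleton)
  have "\<exists>c\<in>?C. A c t \<or> (\<exists>z. A c z \<and> A z t \<and> z \<notin> X \<union> ?F)"
  proof (rule short_link[where b = "8 * k - 3"])
    show "?C \<subseteq> V - X - ?F" using N_sub by auto
    have "0 < card ?C" using cC k by arith
    then show "?C \<noteq> {}" by (metis card.empty less_irrefl)
    show "card (N t - X) \<le> card (N c - X)" if "c \<in> ?C" for c
      using low[OF L(3), of c] that False N_sub[of x] by (auto simp: deg_def)
    show "card (N c \<inter> ?F - X) \<le> 8 * k - 3" for c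
    proof -
      have "card (N c \<inter> ?F - X) \<le> card ?F" using fL fin by (intro card_mono) auto
      then show ?thesis using cF by simp
    qed
    show "2 * (8 * k - 3) \<le> card ?C" using cC k by arith
  qed (use False L in auto)
  then obtain c where c: "c \<in> ?C" and cz: "A c t \<or> (\<exists>z. A c z \<and> A z t \<and> z \<notin> X \<union> ?F)" by blast
  have cV: "c \<in> V - X - Y - L - F" using c False N_sub[of x] by auto
  from cz show ?thesis
  proof
    assume "A c t"
    then have "reach A ({c} \<union> {x, t}) x t"
      using c by (intro reach_trans[OF reach_step[of A x c] reach_step[of A c t]]) auto
    then show ?thesis using cV by (intro exI[of _ "{c}"]) auto
  next
    assume "\<exists>z. A c z \<and> A z t \<and> z \<notin> X \<union> ?F"
    then obtain z where z: "A c z" "A z t" "z \<notin> X \<union> ?F" by blast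
    then have zV: "z \<in> V - X - Y - L - F" using arc_in by auto
    have "reach A ({c, z} \<union> {x, t}) x t"
      using c z by (intro reach_trans[OF reach_trans[OF reach_step[of A x c] reach_step[of A c z]]
            reach_step[of A z t]]) auto
    then show ?thesis using cV zV by (intro exI[of _ "{c, z}"]) (auto simp: card_insert_if)
  qed
qed

text \<open>Build the routes in turn. Before route number n, counted from 0, at most 2n vertices are
  occupied, and n < k gives the bound that \<open>entry_path\<close> needs.\<close>

lemma entry_paths:
  assumes k: "1 \<le> k" and X: "X \<subseteq> V" "card X = k" "xs ` {..<k} \<subseteq> X" and Y: "finite Y" "card Y = k"
    and L: "L \<subseteq> V - X - Y" "card L = 5 * k" "e ` {..<k} \<subseteq> L"
    and low: "\<And>l u. l \<in> L \<Longrightarrow> u \<in> V - X - Y - L \<Longrightarrow> deg X l \<le> deg X u"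
    and out: "\<And>v. v \<in> V \<Longrightarrow> 28 * k - 13 \<le> card (N v)"
  shows "\<exists>D. (\<forall>i<k. D i \<subseteq> V - X - Y - L \<and> card (D i) \<le> 2 \<and> reach A (D i \<union> {xs i, e i}) (xs i) (e i)) \<and>
    (\<forall>i<k. \<forall>j<k. i \<noteq> j \<longrightarrow> D i \<inter> D j = {})"
proof -
  have "\<exists>D. (\<forall>i<n. D i \<subseteq> V - X - Y - L \<and> card (D i) \<le> 2 \<and> reach A (D i \<union> {xs i, e i}) (xs i) (e i)) \<and>
    (\<forall>i<n. \<forall>j<n. i \<noteq> j \<longrightarrow> D i \<inter> D j = {})" if "n \<le> k" for n
    using that
  proof (induction n)
    case (Suc n)
    from Suc.IH[OF Suc_leD[OF Suc.prems]]
    obtain D where D0: "(\<forall>i<n. D i \<subseteq> V - X - Y - L \<and> card (D i) \<le> 2 \<and> reach A (D i \<union> {xs i, e i}) (xs i) (e i)) \<and>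
      (\<forall>i<n. \<forall>j<n. i \<noteq> j \<longrightarrow> D i \<inter> D j = {})" by (rule exE)
    note D = D0[THEN conjunct1, rule_format] D0[THEN conjunct2, rule_format]
    let ?F = "\<Union>i\<in>{..<n}. D i"
    have "card ?F \<le> card {..<n} * 2" using D(1) by (intro card_UN_bound) auto
    then have cF: "card ?F + 2 \<le> 2 * k" using Suc.prems by simp
    have fF: "finite ?F" by (rule finite_sub) (use D(1) in blast)
    have n: "n < k" using Suc.prems by simp
    have "\<exists>D' \<subseteq> V - X - Y - L - ?F. card D' \<le> 2 \<and> reach A (D' \<union> {xs n, e n}) (xs n) (e n)"
      by (rule entry_path[OF k X(1,2) _ Y(2) L(1,2) _ low cF out Y(1) fF]) (use X L n in auto)
    then obtain D' where D': "D' \<subseteq> V - X - Y - L - ?F" "card D' \<le> 2" "reach A (D' \<union> {xs n, e n}) (xs n) (e n)"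
      by blast
    have "\<forall>i<Suc n. (D(n := D')) i \<subseteq> V - X - Y - L \<and> card ((D(n := D')) i) \<le> 2 \<and>
        reach A ((D(n := D')) i \<union> {xs i, e i}) (xs i) (e i)"
      using D(1) D' by (auto simp: less_Suc_eq)
    moreover have "\<forall>i<Suc n. \<forall>j<Suc n. i \<noteq> j \<longrightarrow> (D(n := D')) i \<inter> (D(n := D')) j = {}"
      using D(2) D'(1) by (auto simp: less_Suc_eq)
    ultimately show ?case by blast
  qed simp
  then show ?thesis by blast
qed

end

text \<open>Situation after the first routes and the shortest linkage have been chosen: route i consists of
  \<open>xs i\<close>, \<open>D i\<close>, \<open>e i\<close>, \<open>l i\<close>, a yet to be found set of at most two vertices, and \<open>P i\<close>.\<close>
locale routing = finite_tournament +
  fixes k :: nat and X L :: "'a set" and xs e l :: "nat \<Rightarrow> 'a" and D :: "nat \<Rightarrow> 'a set" and P :: "nat \<Rightarrow> 'a list"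
  assumes k: "1 \<le> k"
    and X: "X \<subseteq> V" "card X = k" "xs ` {..<k} \<subseteq> X"
    and L: "L \<subseteq> V - X" "e ` {..<k} \<subseteq> L" "l ` {..<k} \<subseteq> L"
    and D: "\<And>i. i < k \<Longrightarrow> D i \<subseteq> V - X - L" "\<And>i. i < k \<Longrightarrow> card (D i) \<le> 2"
    and P: "\<And>i. i < k \<Longrightarrow> P i \<noteq> []" "\<And>i. i < k \<Longrightarrow> set (P i) \<subseteq> V - X" "\<And>i. i < k \<Longrightarrow> hd (P i) \<in> L"
    and low: "\<And>v u. v \<in> L \<Longrightarrow> u \<in> V - X - L - (\<Union>i<k. set (P i)) \<Longrightarrow> deg X v \<le> deg X u"
    and out: "\<And>v. v \<in> V \<Longrightarrow> 28 * k - 13 \<le> card (N v)"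
    and l_out: "\<And>i. i < k \<Longrightarrow> card (N (l i) \<inter> L) \<le> 4 * k"
      "\<And>i j. i < k \<Longrightarrow> j < k \<Longrightarrow> N (l i) \<inter> set (P j) \<subseteq> set (take 2 (P j))"
      "\<And>i j c. i < k \<Longrightarrow> j < k \<Longrightarrow> A (l i) c \<Longrightarrow> c \<notin> X \<union> L \<union> (\<Union>i<k. D i) \<union> (\<Union>i<k. set (P i)) \<Longrightarrow>
         N c \<inter> set (P j) \<subseteq> set (take 3 (P j))"
begin

definition route :: "(nat \<Rightarrow> 'a set) \<Rightarrow> nat \<Rightarrow> 'a set" where
  "route D' i = {xs i, e i, l i} \<union> D i \<union> D' i \<union> set (P i)"

text \<open>Again \<open>short_link\<close>, from the free out-neighbours of \<open>l i\<close> to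
  the first vertex of \<open>P i\<close>. The new vertices need to avoid only the other routes;
  meeting route \<open>i\<close> itself is harmless for reachability.\<close>

lemma exit_path:
  assumes i: "i < k" and D': "\<And>j. j < k \<Longrightarrow> D' j \<subseteq> V" "\<And>j. j < k \<Longrightarrow> card (D' j) \<le> 2"
  shows "\<exists>Z \<subseteq> V - X. card Z \<le> 2 \<and> (\<forall>j<k. j \<noteq> i \<longrightarrow> Z \<inter> route D' j = {}) \<and>
    reach A (Z \<union> {l i, hd (P i)}) (l i) (hd (P i))"
proof -
  let ?J = "{..<k} - {i}" and ?t = "hd (P i)"
  define F where "F = (\<Union>j\<in>?J. route D' j)"
  let ?UD = "\<Union>j<k. D j" and ?UD' = "\<Union>j\<in>?J. D' j" and ?UP = "\<Union>j<k. set (P j)"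
  define C where "C = N (l i) - X - L - ?UD - ?UD' - ?UP"
  have cJ: "card ?J = k - 1" using i by simp
  have fX: "finite X" using X(1) by (rule finite_sub)
  have fUD: "finite ?UD" by (rule finite_sub) (use D(1) in blast)
  have fUD': "finite ?UD'" by (rule finite_sub) (use D'(1) in blast)
  have fD: "finite (D j)" "finite (D' j)" if "j < k" for j
    using D(1)[OF that] D'(1)[OF that] finite_sub by blast+
  have tP: "?t \<in> set (P i)" using P(1)[OF i] by simp
  have liV: "l i \<in> V" using L i by auto
  have "N (l i) \<subseteq> C \<union> X \<union> (N (l i) \<inter> L) \<union> ?UD \<union> ?UD' \<union> (\<Union>j<k. N (l i) \<inter> set (P j) - L)"
    by (auto simp: C_def)
  then have "card (N (l i)) \<le> card (C \<union> X \<union> (N (l i) \<inter> L) \<union> ?UD \<union> ?UD' \<union> (\<Union>j<k. N (l i) \<inter> set (P j) - L))"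
    using fX fUD fUD' by (intro card_mono) (auto simp: C_def)
  also have "\<dots> \<le> card C + card X + card (N (l i) \<inter> L) + card ?UD + card ?UD' + card (\<Union>j<k. N (l i) \<inter> set (P j) - L)"
    by (meson add_le_mono1 card_Un_le order_trans)
  finally have 1: "28 * k - 13 \<le> card C + card X + card (N (l i) \<inter> L) + card ?UD + card ?UD' + card (\<Union>j<k. N (l i) \<inter> set (P j) - L)"
    using out[OF liV] by linarith
  have "card ?UD \<le> card {..<k} * 2" using D(2) by (intro card_UN_bound) auto
  moreover have "card ?UD' \<le> card ?J * 2" using D'(2) by (intro card_UN_bound) auto
  \<comment> \<open>Of the two vertices of \<open>P j\<close> that \<open>l i\<close> can dominate,
    the first lies in \<open>L\<close> and is counted there.\<close>
  moreover have "card (\<Union>j<k. N (l i) \<inter> set (P j) - L) \<le> card {..<k} * 1"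
  proof (intro card_UN_bound)
    fix j assume "j \<in> {..<k}"
    then have j: "j < k" by simp
    have "N (l i) \<inter> set (P j) - L \<subseteq> set (take 1 (tl (P j)))"
      using l_out(2)[OF i j] P(1,3)[OF j] by (cases "P j") (auto simp: take_Suc numeral_2_eq_2)
    then have "card (N (l i) \<inter> set (P j) - L) \<le> card (set (take 1 (tl (P j))))" by (intro card_mono) auto
    also have "\<dots> \<le> 1" using card_length[of "take 1 (tl (P j))"] by simp
    finally show "card (N (l i) \<inter> set (P j) - L) \<le> 1" .
  qed simp
  \<comment> \<open>From 28k - 13 subtract k for \<open>X\<close>, 4k for \<open>L\<close>, 2k for
    \<open>D\<close>, 2(k - 1) for \<open>D'\<close> and k for the paths.\<close>
  ultimately have cC: "18 * (k - 1) + 7 \<le> card C"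
    using 1 X(2) l_out(1)[OF i] cJ k by simp
  have CF: "c \<in> V - X - L - ?UP" "c \<notin> F" if c: "c \<in> C" for c
  proof -
    show "c \<in> V - X - L - ?UP" using c N_sub[of "l i"] unfolding C_def by blast
    have "c \<notin> route D' j" if j: "j \<in> ?J" for j
    proof -
      have "xs j \<in> X" "e j \<in> L" "l j \<in> L" using j X(3) L(2,3) by auto
      moreover have "c \<notin> X" "c \<notin> L" "c \<notin> D j" "c \<notin> D' j" "c \<notin> set (P j)"
        using c j unfolding C_def by blast+
      ultimately show ?thesis unfolding route_def by blast
    qed
    then show "c \<notin> F" unfolding F_def by blast
  qed
  have "\<exists>c\<in>C. A c ?t \<or> (\<exists>z. A c z \<and> A z ?t \<and> z \<notin> X \<union> F)"
  proof (rule short_link[where b = "9 * (k - 1)"])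
    show "C \<subseteq> V - X - F" using CF by blast
    show "C \<noteq> {}" using cC by auto
    show "?t \<notin> C" using tP i unfolding C_def by blast
    show "?t \<in> V" using tP P(2)[OF i] by auto
    show "card (N ?t - X) \<le> card (N c - X)" if "c \<in> C" for c
      using low[OF P(3)[OF i] CF(1)[OF that]] by (simp add: deg_def)
    show "2 * (9 * (k - 1)) \<le> card C" using cC by simp
    fix c assume c: "c \<in> C"
    have "N c \<inter> F - X \<subseteq> (\<Union>j\<in>?J. {e j, l j} \<union> D j \<union> D' j \<union> (N c \<inter> set (P j)))"
      using X(3) unfolding F_def route_def by auto
    then have "card (N c \<inter> F - X) \<le> card (\<Union>j\<in>?J. {e j, l j} \<union> D j \<union> D' j \<union> (N c \<inter> set (P j)))"
      using fD by (intro card_mono) auto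
    \<comment> \<open>Each other route blocks at most nine out-neighbours of \<open>c\<close>:
      \<open>e j\<close>, \<open>l j\<close>, two in \<open>D j\<close>, two in \<open>D' j\<close>
      and three on \<open>P j\<close>. Its start lies in \<open>X\<close> and is not
      counted.\<close>
    also have "\<dots> \<le> card ?J * 9"
    proof (intro card_UN_bound)
      fix j assume "j \<in> ?J"
      then have j: "j < k" by simp
      have "N c \<inter> set (P j) \<subseteq> set (take 3 (P j))"
        using c by (intro l_out(3)[OF i j]) (auto simp: C_def)
      then have "card (N c \<inter> set (P j)) \<le> card (set (take 3 (P j)))" by (intro card_mono) auto
      also have "\<dots> \<le> 3" using card_length[of "take 3 (P j)"] by simp
      finally have "card (N c \<inter> set (P j)) \<le> 3" .
      moreover have "card ({e j, l j} \<union> D j \<union> D' j \<union> (N c \<inter> set (P j))) \<le>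
          card {e j, l j} + card (D j) + card (D' j) + card (N c \<inter> set (P j))"
        by (meson add_le_mono1 card_Un_le order_trans)
      moreover have "card {e j, l j} \<le> 2" by (simp add: card_insert_if)
      ultimately show "card ({e j, l j} \<union> D j \<union> D' j \<union> (N c \<inter> set (P j))) \<le> 9"
        using D(2)[OF j] D'(2)[OF j] by linarith
    qed simp
    finally show "card (N c \<inter> F - X) \<le> 9 * (k - 1)" using cJ by simp
  qed
  then obtain c where c: "c \<in> C" and cz: "A c ?t \<or> (\<exists>z. A c z \<and> A z ?t \<and> z \<notin> X \<union> F)" by blast
  note cV = CF[OF c]
  have lc: "A (l i) c" using c by (simp add: C_def)
  have off: "Z \<inter> route D' j = {}" if "Z \<inter> F = {}" "j < k" "j \<noteq> i" for Z j
    using that unfolding F_def by blast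
  from cz show ?thesis
  proof
    assume "A c ?t"
    then have "reach A ({c} \<union> {l i, ?t}) (l i) ?t"
      using lc by (intro reach_trans[OF reach_step[of A "l i" c] reach_step[of A c ?t]]) auto
    then show ?thesis using cV by (intro exI[of _ "{c}"] conjI allI impI off) auto
  next
    assume "\<exists>z. A c z \<and> A z ?t \<and> z \<notin> X \<union> F"
    then obtain z where z: "A c z" "A z ?t" "z \<notin> X \<union> F" by blast
    have "reach A ({c, z} \<union> {l i, ?t}) (l i) ?t"
      using lc z by (intro reach_trans[OF reach_trans[OF reach_step[of A "l i" c] reach_step[of A c z]]
            reach_step[of A z ?t]]) auto
    moreover have "z \<in> V" using z arc_in by blast
    ultimately show ?thesis using cV z(3)
      by (intro exI[of _ "{c, z}"] conjI allI impI off) (auto simp: card_insert_if)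
  qed
qed

text \<open>Disjointness is maintained for all \<open>k\<close> routes from the beginning, with
  unfinished ones starting from empty \<open>D'\<close>. Each new connection thereby also avoids the
  fixed vertices of routes completed later.\<close>

lemma exit_paths:
  assumes disj: "\<And>i j. i < k \<Longrightarrow> j < k \<Longrightarrow> i \<noteq> j \<Longrightarrow> route (\<lambda>_. {}) i \<inter> route (\<lambda>_. {}) j = {}"
  shows "\<exists>D'. (\<forall>i<k. D' i \<subseteq> V \<and> reach A (route D' i) (l i) (hd (P i))) \<and>
    (\<forall>i<k. \<forall>j<k. i \<noteq> j \<longrightarrow> route D' i \<inter> route D' j = {})"
proof -
  have "\<exists>D'. (\<forall>i<k. D' i \<subseteq> V \<and> card (D' i) \<le> 2) \<and> (\<forall>i<n. reach A (route D' i) (l i) (hd (P i))) \<and>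
    (\<forall>i<k. \<forall>j<k. i \<noteq> j \<longrightarrow> route D' i \<inter> route D' j = {})" if "n \<le> k" for n
    using that
  proof (induction n)
    case 0
    show ?case using disj by (intro exI[of _ "\<lambda>_. {}"]) auto
  next
    case (Suc n)
    from Suc.IH[OF Suc_leD[OF Suc.prems]]
    obtain D' where D0: "(\<forall>i<k. D' i \<subseteq> V \<and> card (D' i) \<le> 2) \<and> (\<forall>i<n. reach A (route D' i) (l i) (hd (P i))) \<and>
      (\<forall>i<k. \<forall>j<k. i \<noteq> j \<longrightarrow> route D' i \<inter> route D' j = {})" by (rule exE)
    have D': "D' i \<subseteq> V" "card (D' i) \<le> 2" if "i < k" for i using D0 that by blast+
    note D' = D' D0[THEN conjunct2, THEN conjunct1, rule_format] D0[THEN conjunct2, THEN conjunct2, rule_format]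
    have n: "n < k" using Suc.prems by simp
    obtain Z where Z: "Z \<subseteq> V - X" "card Z \<le> 2" "\<And>j. j < k \<Longrightarrow> j \<noteq> n \<Longrightarrow> Z \<inter> route D' j = {}"
      "reach A (Z \<union> {l n, hd (P n)}) (l n) (hd (P n))"
      using exit_path[of n D', OF n D'(1,2)] by blast
    let ?D = "D'(n := Z)"
    have same: "route ?D i = route D' i" if "i \<noteq> n" for i using that by (simp add: route_def)
    have new: "route ?D n \<subseteq> route D' n \<union> Z" by (auto simp: route_def)
    have "Z \<union> {l n, hd (P n)} \<subseteq> route ?D n" using P(1)[OF n] by (auto simp: route_def)
    then have "reach A (route ?D n) (l n) (hd (P n))" using reach_mono[OF Z(4)] by blast
    then have 1: "\<forall>i<Suc n. reach A (route ?D i) (l i) (hd (P i))"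
      using D'(3) same by (metis less_Suc_eq nat_neq_iff)
    have 2: "route ?D i \<inter> route ?D j = {}" if ij: "i < k" "j < k" "i \<noteq> j" for i j
    proof -
      consider "i = n" | "j = n" | "i \<noteq> n" "j \<noteq> n" by blast
      then show ?thesis
      proof cases
        case 1 then show ?thesis using new same[of j] Z(3)[OF ij(2)] D'(4)[OF ij] ij by blast
      next
        case 2 then show ?thesis using new same[of i] Z(3)[OF ij(1)] D'(4)[OF ij] ij by blast
      next
        case 3 then show ?thesis using same D'(4)[OF ij] by simp
      qed
    qed
    have 3: "\<forall>i<k. ?D i \<subseteq> V \<and> card (?D i) \<le> 2" using D' Z by auto
    show ?case using 1 2 3 by blast
  qed
  from this[of k] show ?thesis by (metis le_refl)
qed

end

section \<open>Assembling the linkage\<close>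

theorem theorem1p3:
  fixes k :: nat and V :: "'a set" and A :: "'a \<Rightarrow> 'a \<Rightarrow> bool"
  assumes "k \<ge> 1"
    and "tournament V A"
    and "k_strong (13 * k - 6) V A"
    and "\<forall>v\<in>V. out_degree V A v \<ge> 28 * k - 13"
  shows "k_linked k V A"
  unfolding k_linked_def
proof (intro allI impI, elim conjE)
  fix xs ys :: "nat \<Rightarrow> 'a"
  assume xs: "inj_on xs {..<k}" "xs ` {..<k} \<subseteq> V" and ys: "inj_on ys {..<k}" "ys ` {..<k} \<subseteq> V"
    and xy: "xs ` {..<k} \<inter> ys ` {..<k} = {}"
  interpret finite_tournament V A using assms(2) by unfold_locales
  define X where "X = xs ` {..<k}"
  define Y where "Y = ys ` {..<k}"
  have k: "1 \<le> k" using assms(1) .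
  have out: "28 * k - 13 \<le> card (N v)" if "v \<in> V" for v
  proof -
    have "{y \<in> V. A v y} = N v" using N_sub by auto
    then show ?thesis using assms(4) that by (auto simp: out_degree_def)
  qed
  have X: "X \<subseteq> V" "card X = k" "finite X" "xs ` {..<k} \<subseteq> X"
    using xs by (auto simp: X_def card_image)
  have Y: "Y \<subseteq> V" "card Y = k" "finite Y" using ys by (auto simp: Y_def card_image)
  have XY: "X \<inter> Y = {}" using xy by (simp add: X_def Y_def)
  have "xs 0 \<in> V" using xs(2) k by auto
  then have "28 * k - 13 \<le> card V" using out[of "xs 0"] card_mono[OF finite_V N_sub[of "xs 0"]] by linarith
  moreover have "card (V - X - Y) = card V - k - k"
    using X Y XY by (subst card_Diff_subset) (auto simp: card_Diff_subset)
  \<comment> \<open>Some out-degree of at least 28k - 13 already makes \<open>V\<close> large enough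
    to contain \<open>L\<close> besides the 2k terminals.\<close>
  ultimately have "5 * k \<le> card (V - X - Y)" using k by linarith
  then obtain L where L: "L \<subseteq> V - X - Y" "card L = 5 * k"
    and low: "\<And>l u. l \<in> L \<Longrightarrow> u \<in> V - X - Y - L \<Longrightarrow> deg X l \<le> deg X u"
    using obtain_lowest[of "V - X - Y" "5 * k" "deg X"] finite_V by blast
  have "L \<subseteq> V" using L(1) by auto
  then obtain e S where e: "inj_on e {..<k}" "e ` {..<k} \<subseteq> L" "S \<subseteq> L" "e ` {..<k} \<inter> S = {}"
    and eS: "\<And>i. i < k \<Longrightarrow> k + i < card (N (e i) \<inter> S)" and S_low: "\<And>v. v \<in> S \<Longrightarrow> card (N v \<inter> L) \<le> 4 * k"
    using entries[OF _ L(2)] by metis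
  from entry_paths[OF k X(1,2,4) Y(3,2) L e(2) low out]
  obtain D where D0: "(\<forall>i<k. D i \<subseteq> V - X - Y - L \<and> card (D i) \<le> 2 \<and> reach A (D i \<union> {xs i, e i}) (xs i) (e i)) \<and>
    (\<forall>i<k. \<forall>j<k. i \<noteq> j \<longrightarrow> D i \<inter> D j = {})" by (rule exE)
  have D: "D i \<subseteq> V - X - Y - L" "card (D i) \<le> 2" "reach A (D i \<union> {xs i, e i}) (xs i) (e i)" if "i < k" for i
    using D0 that by blast+
  note D = D D0[THEN conjunct2, rule_format]
  define UD where "UD = (\<Union>i<k. D i)"
  define E where "E = e ` {..<k}"
  define G where "G = V - X - UD - E"
  have UD: "UD \<subseteq> V - X - Y - L" using D(1) by (auto simp: UD_def)
  have GV: "G \<subseteq> V" by (auto simp: G_def)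
  have SG: "S \<subseteq> G" using e L UD by (auto simp: G_def E_def)
  have YG: "Y \<subseteq> G" using Y XY UD e(2) L(1) by (auto simp: G_def E_def)
  have fS: "finite S" using SG GV finite_sub by blast
  have cS: "k \<le> card S"
    using eS[of 0] k card_mono[OF fS, of "N (e 0) \<inter> S"] by simp
  have "\<exists>P. linkage A G S ys k P"
  proof (rule linkage_exists[OF finite_sub[OF GV] SG cS ys(1)])
    show "ys ` {..<k} \<subseteq> G" using YG by (simp add: Y_def)
    fix Z assume Z: "Z \<subseteq> G" "card Z < k"
    have "card UD \<le> card {..<k} * 2" unfolding UD_def using D(2) by (intro card_UN_bound) auto
    moreover have "card E \<le> k" unfolding E_def using card_image_le[of "{..<k}" e] by simp
    moreover have "card (X \<union> UD \<union> E \<union> Z) \<le> card X + card UD + card E + card Z"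
      by (meson add_le_mono1 card_Un_le order_trans)
    \<comment> \<open>At most k + 2k + k + (k - 1) = 5k - 1 vertices are deleted, and this is at
      most 13k - 7 because k is positive.\<close>
    ultimately have "card (X \<union> UD \<union> E \<union> Z) \<le> 13 * k - 6 - 1" using X(2) Z(2) k by simp
    moreover have "X \<union> UD \<union> E \<union> Z \<subseteq> V" using X(1) UD e(2) L(1) Z(1) GV by (auto simp: E_def)
    ultimately have "strongly_connected (V - (X \<union> UD \<union> E \<union> Z)) A"
      using assms(3) by (auto simp: k_strong_def)
    moreover have "V - (X \<union> UD \<union> E \<union> Z) = G - Z" by (auto simp: G_def)
    ultimately show "strongly_connected (G - Z) A" by simp
  qed
  then obtain P0 where "linkage A G S ys k P0" by blast
  from shortest_linkage_exists[OF this] obtain P where P: "linkage A G S ys k P"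
    and "\<forall>j<k. \<forall>q. dipath G A q \<longrightarrow> hd q \<in> S \<longrightarrow> last q = ys j \<longrightarrow>
      (\<forall>i<k. i \<noteq> j \<longrightarrow> set q \<inter> set (P i) = {}) \<longrightarrow> length (P j) \<le> length q" by blast
  then interpret P: shortest_linkage A G S ys k P using SG by unfold_locales
  have Pne: "P j \<noteq> []" "set (P j) \<subseteq> G" if "j < k" for j
    using P.path(1)[OF that] by (auto simp: dipath_iff)
  define H where "H = (\<lambda>j. hd (P j)) ` {..<k}"
  have cH: "card H \<le> k" "finite H" using card_image_le[of "{..<k}" "\<lambda>j. hd (P j)"] by (auto simp: H_def)
  have "i < card (N (e i) \<inter> S - H)" if "i < k" for i
    using eS[OF that] diff_card_le_card_Diff[OF cH(2), of "N (e i) \<inter> S"] cH(1) by linarith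
  then obtain l where l: "inj_on l {..<k}" "\<And>i. i < k \<Longrightarrow> l i \<in> N (e i) \<inter> S - H"
    using distinct_representatives[of k "\<lambda>i. N (e i) \<inter> S - H"] by blast
  have lP: "l i \<notin> set (P j)" if "i < k" "j < k" for i j
    using l(2)[OF that(1)] P.path_inter_sources[OF that(2)] that(2) by (auto simp: H_def)
  have YP: "Y \<subseteq> (\<Union>i<k. set (P i))"
    using P.path(3) Pne(1) by (auto simp: Y_def) (metis last_in_set lessThan_iff)
  interpret R: routing V A k X L xs e l D P
  proof
    show "1 \<le> k" "X \<subseteq> V" "card X = k" "xs ` {..<k} \<subseteq> X" by fact+
    show "L \<subseteq> V - X" "e ` {..<k} \<subseteq> L" "l ` {..<k} \<subseteq> L" using L(1) e(2,3) l(2) by auto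
    fix i assume i: "i < k"
    show "D i \<subseteq> V - X - L" "card (D i) \<le> 2" using D(1,2)[OF i] by auto
    show "P i \<noteq> []" "set (P i) \<subseteq> V - X" "hd (P i) \<in> L"
      using Pne[OF i] P.path(2)[OF i] e(3) by (auto simp: G_def)
    show "card (N (l i) \<inter> L) \<le> 4 * k" using S_low l(2)[OF i] by auto
    have li: "l i \<in> S" using l(2)[OF i] by auto
    fix j assume j: "j < k"
    show "N (l i) \<inter> set (P j) \<subseteq> set (take 2 (P j))"
      by (rule P.out_neighbours_of_unused_source[OF j li lP[OF i]])
    fix c assume c: "A (l i) c" "c \<notin> X \<union> L \<union> (\<Union>i<k. D i) \<union> (\<Union>i<k. set (P i))"
    then have "c \<in> G" using arc_in[OF c(1)] e(2) by (auto simp: G_def UD_def E_def)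
    moreover have "l i \<noteq> c" using c(1) by auto
    ultimately show "N c \<inter> set (P j) \<subseteq> set (take 3 (P j))"
      using c by (intro P.out_neighbours_at_distance_two[OF j li lP[OF i]]) auto
  next
    \<comment> \<open>All of \<open>Y\<close> lies on the paths, so removing the paths removes
      \<open>Y\<close> as well.\<close>
    show "deg X v \<le> deg X u" if "v \<in> L" "u \<in> V - X - L - (\<Union>i<k. set (P i))" for v u
      using low[OF that(1), of u] that(2) YP by blast
    show "28 * k - 13 \<le> card (N v)" if "v \<in> V" for v by (rule out[OF that])
  qed
  have disj: "R.route (\<lambda>_. {}) i \<inter> R.route (\<lambda>_. {}) j = {}" if ij: "i < k" "j < k" "i \<noteq> j" for i j
  proof -
    \<comment> \<open>The sets \<open>X\<close>, \<open>E\<close>, \<open>UD\<close> and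
      \<open>G\<close> are pairwise disjoint and cover all routes; it is enough to compare two
      routes inside each of them.\<close>
    have "X \<inter> L = {}" "X \<inter> UD = {}" "UD \<inter> L = {}" "E \<subseteq> L" "G \<inter> (X \<union> UD \<union> E) = {}"
      using L(1) UD e(2) by (auto simp: G_def E_def)
    then have cl: "X \<inter> E = {}" "X \<inter> UD = {}" "X \<inter> G = {}" "E \<inter> UD = {}" "E \<inter> G = {}" "UD \<inter> G = {}"
      by blast+
    have parts: "R.route (\<lambda>_. {}) m \<inter> X \<subseteq> {xs m}" "R.route (\<lambda>_. {}) m \<inter> E \<subseteq> {e m}"
        "R.route (\<lambda>_. {}) m \<inter> UD \<subseteq> D m" "R.route (\<lambda>_. {}) m \<inter> G \<subseteq> insert (l m) (set (P m))"
        "R.route (\<lambda>_. {}) m \<subseteq> X \<union> E \<union> UD \<union> G" if "m < k" for m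
    proof -
      have "xs m \<in> X" "e m \<in> E" "D m \<subseteq> UD" "l m \<in> G" "set (P m) \<subseteq> G"
        using that X(4) l(2)[OF that] SG Pne(2)[OF that] by (auto simp: E_def UD_def)
      then show "R.route (\<lambda>_. {}) m \<inter> X \<subseteq> {xs m}" "R.route (\<lambda>_. {}) m \<inter> E \<subseteq> {e m}"
        "R.route (\<lambda>_. {}) m \<inter> UD \<subseteq> D m" "R.route (\<lambda>_. {}) m \<inter> G \<subseteq> insert (l m) (set (P m))"
        "R.route (\<lambda>_. {}) m \<subseteq> X \<union> E \<union> UD \<union> G"
        using cl unfolding R.route_def by blast+
    qed
    have "xs i \<noteq> xs j" "e i \<noteq> e j" "l i \<noteq> l j"
      using ij xs(1) e(1) l(1) by (auto simp: inj_on_def)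
    then have "{xs i} \<inter> {xs j} = {}" "{e i} \<inter> {e j} = {}"
      "insert (l i) (set (P i)) \<inter> insert (l j) (set (P j)) = {}"
      using P.path(4)[OF ij] lP[OF ij(1,2)] lP[OF ij(2,1)] by auto
    note dis = this D(4)[OF ij]
    show ?thesis
    proof (rule ccontr)
      assume "\<not> ?thesis"
      then obtain v where v: "v \<in> R.route (\<lambda>_. {}) i" "v \<in> R.route (\<lambda>_. {}) j" by blast
      then consider "v \<in> X" | "v \<in> E" | "v \<in> UD" | "v \<in> G" using parts(5)[OF ij(1)] by blast
      then show False
      proof cases
        case 1 then show False using v parts(1)[OF ij(1)] parts(1)[OF ij(2)] dis(1) by blast
      next
        case 2 then show False using v parts(2)[OF ij(1)] parts(2)[OF ij(2)] dis(2) by blast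
      next
        case 3 then show False using v parts(3)[OF ij(1)] parts(3)[OF ij(2)] dis(4) by blast
      next
        case 4 then show False using v parts(4)[OF ij(1)] parts(4)[OF ij(2)] dis(3) by blast
      qed
    qed
  qed
  from R.exit_paths[OF disj]
  obtain D' where D0': "(\<forall>i<k. D' i \<subseteq> V \<and> reach A (R.route D' i) (l i) (hd (P i))) \<and>
    (\<forall>i<k. \<forall>j<k. i \<noteq> j \<longrightarrow> R.route D' i \<inter> R.route D' j = {})" by (rule exE)
  have D': "D' i \<subseteq> V" "reach A (R.route D' i) (l i) (hd (P i))" if "i < k" for i
    using D0' that by blast+
  note D' = D' D0'[THEN conjunct2, rule_format]
  have "\<exists>p. dipath_from_to V A p (xs i) (ys i) \<and> set p \<subseteq> R.route D' i" if i: "i < k" for i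
  proof -
    \<comment> \<open>Concatenate the entry route, the arc from \<open>e i\<close> to
      \<open>l i\<close>, the exit route and \<open>P i\<close>, all inside the vertex set of route
      \<open>i\<close>.\<close>
    have "reach A (R.route D' i) (xs i) (e i)"
      by (rule reach_mono[OF D(3)[OF i]]) (auto simp: R.route_def)
    moreover have "reach A (R.route D' i) (e i) (l i)"
      using l(2)[OF i] by (intro reach_step) (auto simp: R.route_def)
    moreover have "reach A (set (P i)) (hd (P i)) (ys i)"
      using dipath_imp_reach[OF P.path(1)[OF i]] P.path(3)[OF i] by simp
    then have "reach A (R.route D' i) (hd (P i)) (ys i)"
      by (rule reach_mono) (auto simp: R.route_def)
    ultimately have "reach A (R.route D' i) (xs i) (ys i)" using D'(2)[OF i] by (blast intro: reach_trans)
    moreover have "ys i \<in> set (P i)"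
      using last_in_set[OF Pne(1)[OF i]] P.path(3)[OF i] by simp
    then have "ys i \<in> R.route D' i" by (simp add: R.route_def)
    ultimately have "\<exists>p. dipath_from_to (R.route D' i) A p (xs i) (ys i)" by (rule reach_imp_dipath)
    then obtain p where p: "dipath_from_to (R.route D' i) A p (xs i) (ys i)" by (rule exE)
    have "e i \<in> L" "l i \<in> L" "xs i \<in> X" using i e(2,3) l(2) X(4) by auto
    then have "xs i \<in> V" "e i \<in> V" "l i \<in> V" "D i \<subseteq> V" "D' i \<subseteq> V" "set (P i) \<subseteq> V"
      using D(1)[OF i] D'(1)[OF i] Pne(2)[OF i] GV L(1) X(1) by auto
    then have "R.route D' i \<subseteq> V" by (simp add: R.route_def)
    then have "dipath_from_to V A p (xs i) (ys i) \<and> set p \<subseteq> R.route D' i"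
      using p by (auto simp: dipath_from_to_def dipath_def)
    then show ?thesis by (rule exI)
  qed
  then have "\<exists>Q. \<forall>i. i < k \<longrightarrow> dipath_from_to V A (Q i) (xs i) (ys i) \<and> set (Q i) \<subseteq> R.route D' i"
    by (intro choice) blast
  then obtain Q where Q: "dipath_from_to V A (Q i) (xs i) (ys i)" "set (Q i) \<subseteq> R.route D' i" if "i < k" for i
    by blast
  have "set (Q i) \<inter> set (Q j) = {}" if "i < k" "j < k" "i \<noteq> j" for i j
    using Q(2)[OF that(1)] Q(2)[OF that(2)] D'(3)[OF that] by blast
  then show "\<exists>P. (\<forall>i<k. dipath_from_to V A (P i) (xs i) (ys i)) \<and>
      (\<forall>i<k. \<forall>j<k. i \<noteq> j \<longrightarrow> set (P i) \<inter> set (P j) = {})"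
    using Q(1) by blast
qed

end
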